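(* Let $A,B,C$ be three binary forms of respective orders $a,b,c$. Let $r,s$ be integers such that $0\le r\le\min(b,c)$ and $0\le s\le\min(a,b+c-2r)$. Then $$(A,(B,C)_r)_s=\sum_{k\in\mathbb Z}\theta_k\,((A,B)_k,C)_{r+s-k},$$ where $\theta_k=0$ (and the corresponding term is omitted) unless $k$ satisfies $$k\ge0,\quad k\ge r+s-c,\quad k\le a,\quad k\le b,\quad k\le a+b-r-s,\quad k\le r+s,$$ and for $k$ satisfying these inequalities $$\theta_k=(-1)^{a+b+c+r+s}\;T_1\;\frac{(a+b-2k+1)!\;T_2(k)}{(a+b-k+1)!\,(a+b+c-r-s-k+1)!},$$ with $$T_1=\frac{r!\,(b-r)!\,(c-r)!\,s!\,(a-s)!\,(b+c-2r-s)!}{(b+c-2r)!}$$ and $$T_2(k)=\sum_z(-1)^z(z+1)!\,\big[(z-a-b+k)!\,(z-b-c+r)!\,(z-a-b-c+2r+s)!\,(z-a-b-c+r+s+k)!\,(a+b+c-r-s-z)!\,(a+b+c-r-k-z)!\,(a+2b+c-2r-s-k-z)!\big]^{-1},$$ the sum being over all integers $z$ for which the arguments of all the factorials in the denominator are $\ge0$.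
   Context: Binary forms are homogeneous polynomials in $x_1,x_2$ over $\mathbb C$; the order of a form is its degree. For $A$ of order $m$, $B$ of order $n$ and $0\le r\le\min(m,n)$, the $r$-th transvectant is the form of order $m+n-2r$ $$(A,B)_r=\frac{(m-r)!\,(n-r)!}{m!\,n!}\sum_{i=0}^r(-1)^i\binom ri\frac{\partial^rA}{\partial x_1^{r-i}\partial x_2^i}\frac{\partial^rB}{\partial x_2^{r-i}\partial x_1^i}.$$ *)

theory Defs
  imports Complex_Main "HOL-Computational_Algebra.Polynomial"
begin

text \<open>
  Polynomials in x1, x2 over the complex numbers are elements of C[x1][x2]: the coefficient of
  x1^i x2^j in A is \<^term>\<open>coeff (coeff A j) i\<close>.  So the outer variable is x2 and the inner one is x1.
\<close>

type_synonym bipoly = "complex poly poly"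

text \<open>The zero polynomial counts as a form of every order.  For this reason the orders are explicit
  arguments of the transvectant below.\<close>

definition binary_form :: "nat \<Rightarrow> bipoly \<Rightarrow> bool" where
  "binary_form m A \<longleftrightarrow> (\<forall>i j. coeff (coeff A j) i \<noteq> 0 \<longrightarrow> i + j = m)"

definition dx1 :: "bipoly \<Rightarrow> bipoly" where
  "dx1 A = map_poly pderiv A"

definition dx2 :: "bipoly \<Rightarrow> bipoly" where
  "dx2 A = pderiv A"

definition scale :: "complex \<Rightarrow> bipoly \<Rightarrow> bipoly" where
  "scale x A = smult [:x:] A"

text \<open>\<open>transvectant m n r A B\<close> is meant for A of order m, B of order n and r at most min m n; only then
  are the natural number subtractions exact.\<close>

definition transvectant :: "nat \<Rightarrow> nat \<Rightarrow> nat \<Rightarrow> bipoly \<Rightarrow> bipoly \<Rightarrow> bipoly" where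
  "transvectant m n r A B =
     scale (fact (m - r) * fact (n - r) / (fact m * fact n))
       (\<Sum>i=0..r. scale ((-1) ^ i * of_nat (r choose i))
          ((dx1 ^^ (r - i)) ((dx2 ^^ i) A) * (dx2 ^^ (r - i)) ((dx1 ^^ i) B)))"

text \<open>Factorial of an integer, used only at nonnegative arguments.  The parameters below are integers,
  so that no subtraction is truncated.\<close>

definition ifact :: "int \<Rightarrow> complex" where
  "ifact n = fact (nat n)"

definition K_range :: "int \<Rightarrow> int \<Rightarrow> int \<Rightarrow> int \<Rightarrow> int \<Rightarrow> int set" where
  "K_range a b c r s =
     {k. k \<ge> 0 \<and> k \<ge> r + s - c \<and> k \<le> a \<and> k \<le> b \<and> k \<le> a + b - r - s \<and> k \<le> r + s}"

definition Z_range :: "int \<Rightarrow> int \<Rightarrow> int \<Rightarrow> int \<Rightarrow> int \<Rightarrow> int \<Rightarrow> int set" where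
  "Z_range a b c r s k =
     {z. z - a - b + k \<ge> 0 \<and> z - b - c + r \<ge> 0 \<and> z - a - b - c + 2 * r + s \<ge> 0 \<and>
         z - a - b - c + r + s + k \<ge> 0 \<and> a + b + c - r - s - z \<ge> 0 \<and>
         a + b + c - r - k - z \<ge> 0 \<and> a + 2 * b + c - 2 * r - s - k - z \<ge> 0}"

lemma finite_K_range: "finite (K_range a b c r s)"
  by (rule finite_subset[of _ "{0..a}"]) (auto simp: K_range_def)

lemma finite_Z_range: "finite (Z_range a b c r s k)"
  by (rule finite_subset[of _ "{a + b - k..a + b + c - r - s}"]) (auto simp: Z_range_def)

definition T1 :: "int \<Rightarrow> int \<Rightarrow> int \<Rightarrow> int \<Rightarrow> int \<Rightarrow> complex" where
  "T1 a b c r s =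
     ifact r * ifact (b - r) * ifact (c - r) * ifact s * ifact (a - s) * ifact (b + c - 2 * r - s)
       / ifact (b + c - 2 * r)"

definition T2 :: "int \<Rightarrow> int \<Rightarrow> int \<Rightarrow> int \<Rightarrow> int \<Rightarrow> int \<Rightarrow> complex" where
  "T2 a b c r s k =
     (\<Sum>z\<in>Z_range a b c r s k. (-1) powi z * ifact (z + 1) *
        inverse (ifact (z - a - b + k) * ifact (z - b - c + r) *
          ifact (z - a - b - c + 2 * r + s) * ifact (z - a - b - c + r + s + k) *
          ifact (a + b + c - r - s - z) * ifact (a + b + c - r - k - z) *
          ifact (a + 2 * b + c - 2 * r - s - k - z)))"

definition theta :: "int \<Rightarrow> int \<Rightarrow> int \<Rightarrow> int \<Rightarrow> int \<Rightarrow> int \<Rightarrow> complex" where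
  "theta a b c r s k =
     (if k \<in> K_range a b c r s
      then (-1) powi (a + b + c + r + s) * T1 a b c r s *
             (ifact (a + b - 2 * k + 1) * T2 a b c r s k
               / (ifact (a + b - k + 1) * ifact (a + b + c - r - s - k + 1)))
      else 0)"

end

theory Submission
  imports Defs "HOL-Computational_Algebra.Formal_Power_Series"
begin

text \<open>
  Both sides are trilinear in A, B, C, and a linear operator that vanishes on the m-th powers of
  all linear forms \<open>x1 + t x2\<close> vanishes on all forms of order m (\<open>linear_op_zero_on_forms\<close>).  So A, B, C may
  be taken as powers of linear forms with parameters t, u, v.  For these, all transvectants are
  explicit sums of products of the brackets \<open>v - u\<close>, \<open>u - t\<close>, \<open>v - t\<close> and of the linear forms
  (\<open>transvectant_lform_product\<close>).  Multiplied by the linear forms that they lack, the brackets become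
  three polynomials x, z and y, and the Pluecker relation says \<open>y = x + z\<close>.  With \<open>n = r + s\<close>, the
  assertion becomes an expansion of one homogeneous polynomial of degree n in x and z, coming from
  \<open>(A, (B, C)_r)_s\<close>, in the polynomials that come from \<open>((A, B)_k, C)_{n-k}\<close>.

  The k-th of the latter is divisible by \<open>z^k\<close>.  Hence the comparison of the coefficients of
  \<open>z^l x^(n-l)\<close> is a triangular system for the coefficients of the expansion.  All entries of the system are
  quotients of binomial coefficients (\<open>right_coeff\<close>, \<open>left_coeff\<close>), and the inverse matrix is known in closed form
  because a certain alternating sum telescopes (\<open>inv_left_inverse\<close>).  The solution is a single sum, a
  terminating balanced 4F3 series.  It is not the sum T2, which is another balanced 4F3, but
  Whipple's transformation identifies the two (\<open>theta_eq_sum\<close>).  That transformation is the comparison of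
  coefficients in a product of two Euler transformations of Gauss series whose powers of \<open>1 - X\<close>
  cancel (\<open>hypergeom_fps_product\<close>), and Euler's transformation is, coefficient by coefficient, the
  theorem of Pfaff and Saalschuetz (\<open>saalschuetz\<close>).

  The triangular system only concerns \<open>l \<le> K\<close>, where K is the largest admissible k.  If n exceeds a or b,
  then K is smaller than n, and the higher coefficients need an argument of their own.  At \<open>x = 1\<close>, the
  difference of the two sides is a polynomial in z with a zero of order at least \<open>K + 1\<close> at 0, a zero of
  order at least \<open>n - b\<close> at -1, and degree at most \<open>min a n\<close>.  That is too many zeros, so it vanishes
  (\<open>coefficient_identity\<close>).
\<close>

section \<open>Reciprocal factorials and the Saalschuetz sum\<close>

text \<open>
  The reciprocal factorial vanishes at negative integers, as 1/Gamma does.  With this convention a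
  sum over the indices at which all factorial arguments are nonnegative can be taken over an interval.
\<close>

definition rfact :: "int \<Rightarrow> complex" where
  "rfact i = (if i < 0 then 0 else 1 / fact (nat i))"

text \<open>
  The recursion of 1/Gamma has no exceptional point: at \<open>i = -1\<close> the right-hand side has the factor 0.
\<close>

lemma rfact_recursion: "rfact i = of_int (i + 1) * rfact (i + 1)"
proof -
  consider "i < - 1" | "i = - 1" | "i \<ge> 0" by linarith
  then show ?thesis
  proof cases
    case 3
    then have "nat (i + 1) = Suc (nat i)" by simp
    moreover have "of_int (i + 1) = (of_nat (Suc (nat i)) :: complex)"
      using 3 by (simp add: of_nat_nat)
    ultimately show ?thesis
      using 3 by (simp add: rfact_def del: of_nat_Suc)
  qed (simp_all add: rfact_def)
qed

lemma rfact_pochhammer: "rfact i = pochhammer (of_int (i + 1)) n * rfact (i + int n)"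
proof (induction n)
  case (Suc n)
  then show ?case
    using rfact_recursion[of "i + int n"] by (simp add: pochhammer_Suc algebra_simps)
qed simp

lemma rfact_of_nat [simp]: "rfact (int n) = 1 / fact n"
  by (simp add: rfact_def)

lemma pochhammer_neg_nat:
  "pochhammer (- of_nat N) j = (-1) ^ j * fact N * rfact (int N - int j)"
proof (induction j)
  case (Suc j)
  have "rfact (int N - int (Suc j)) = of_int (int N - int j) * rfact (int N - int j)"
    using rfact_recursion[of "int N - int (Suc j)"] by simp
  show ?case unfolding pochhammer_Suc Suc \<open>rfact (int N - int (Suc j)) = _\<close>
    by (simp add: algebra_simps)
qed simp

lemma pochhammer_pos_nat:
  "pochhammer (of_nat N + 1) j = (fact (N + j) / fact N :: complex)"
proof (induction j)
  case (Suc j)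
  then show ?case by (simp add: pochhammer_Suc algebra_simps add_divide_distrib)
qed simp

text \<open>
  Pascal's rule in summed form.  It is the induction step for the Saalschuetz sum,
  the Leibniz rule, and the binomial theorem for commuting operators.
\<close>

lemma sum_choose_Suc:
  fixes f :: "nat \<Rightarrow> 'a::comm_ring_1"
  shows "(\<Sum>j\<le>Suc N. of_nat (Suc N choose j) * f j) =
    (\<Sum>j\<le>N. of_nat (N choose j) * (f j + f (Suc j)))"
proof -
  have "(\<Sum>j\<le>Suc N. of_nat (Suc N choose j) * f j) =
      (f 0 + (\<Sum>j\<le>N. of_nat (N choose Suc j) * f (Suc j))) + (\<Sum>j\<le>N. of_nat (N choose j) * f (Suc j))"
    by (subst sum.atMost_Suc_shift) (simp add: algebra_simps sum.distrib)
  also have "f 0 + (\<Sum>j\<le>N. of_nat (N choose Suc j) * f (Suc j)) =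
      (\<Sum>j\<le>Suc N. of_nat (N choose j) * f j)"
    by (subst sum.atMost_Suc_shift) simp
  also have "\<dots> = (\<Sum>j\<le>N. of_nat (N choose j) * f j)"
    by (simp add: binomial_eq_0)
  finally show ?thesis
    by (simp add: algebra_simps sum.distrib)
qed

text \<open>
  With \<open>w = c - u - v\<close> and generic parameters this is \<open>(c)_N (w)_N\<close> times the terminating balanced series
  \<open>3F2(u, v, -N; c, 1 - N - w; 1)\<close>.  Clearing the denominators makes it a polynomial in the parameters,
  so that integer values \<open>c \<le> 0\<close>, which occur below, are not exceptional.
\<close>

definition saal :: "complex \<Rightarrow> complex \<Rightarrow> complex \<Rightarrow> nat \<Rightarrow> complex" where
  "saal u v c N = (\<Sum>j\<le>N. of_nat (N choose j) * (pochhammer u j * pochhammer v j *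
     pochhammer (c + of_nat j) (N - j) * pochhammer (c - u - v) (N - j)))"

text \<open>
  The third Pochhammer factor is that of \<open>saal u v (c + 1) N\<close>, the fourth that of \<open>saal u v c N\<close>.  The sum
  serves only to be eliminated between \<open>saal_Suc\<close> and \<open>saal_shift\<close>.
\<close>

definition saal_contiguous :: "complex \<Rightarrow> complex \<Rightarrow> complex \<Rightarrow> nat \<Rightarrow> complex" where
  "saal_contiguous u v c N = (\<Sum>j\<le>N. of_nat (N choose j) * (pochhammer u j * pochhammer v j *
     pochhammer (c + 1 + of_nat j) (N - j) * pochhammer (c - u - v) (N - j)))"

text \<open>
  After Pascal's rule the bracket \<open>(c+j)(w+N-j) + (u+j)(v+j)\<close> remains in each term; it equals
  \<open>(c-u)(c-v) + N(c+j)\<close>, whose two summands give the two sums on the right.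
\<close>

lemma saal_Suc:
  "saal u v c (Suc N) =
    (c - u) * (c - v) * saal_contiguous u v c N + of_nat N * (c + of_nat N) * saal u v c N"
proof -
  define w where "w = c - u - v"
  have step: "pochhammer u j * pochhammer v j * pochhammer (c + of_nat j) (Suc N - j) *
        pochhammer w (Suc N - j) +
      pochhammer u (Suc j) * pochhammer v (Suc j) * pochhammer (c + of_nat (Suc j)) (Suc N - Suc j) *
        pochhammer w (Suc N - Suc j) =
      (c - u) * (c - v) * (pochhammer u j * pochhammer v j * pochhammer (c + 1 + of_nat j) (N - j) *
        pochhammer w (N - j)) +
      of_nat N * (c + of_nat N) * (pochhammer u j * pochhammer v j * pochhammer (c + of_nat j) (N - j) *
        pochhammer w (N - j))"
    (is "?l = ?r") if jle: "j \<le> N" for j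
  proof -
    obtain i where N: "N = j + i" using le_Suc_ex[OF jle] by blast
    define p where "p = pochhammer (c + 1 + of_nat j) i"
    have s1: "pochhammer (c + of_nat j) (Suc i) = (c + of_nat j) * p"
      by (simp add: pochhammer_rec p_def algebra_simps)
    have s2: "pochhammer (c + of_nat j) (Suc i) = pochhammer (c + of_nat j) i * (c + of_nat N)"
      by (simp add: pochhammer_Suc N algebra_simps)
    have "?r = (c - u) * (c - v) * (pochhammer u j * pochhammer v j * p * pochhammer w i) +
        of_nat N * (pochhammer u j * pochhammer v j * pochhammer (c + of_nat j) (Suc i) * pochhammer w i)"
      by (simp add: s2 p_def N algebra_simps)
    also have "\<dots> = pochhammer u j * pochhammer v j * pochhammer w i * p *
        ((c - u) * (c - v) + of_nat N * (c + of_nat j))"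
      unfolding s1 by (simp add: algebra_simps)
    also have "(c - u) * (c - v) + of_nat N * (c + of_nat j) =
        (c + of_nat j) * (w + of_nat i) + (u + of_nat j) * (v + of_nat j)"
      by (simp add: w_def N algebra_simps)
    also have "pochhammer u j * pochhammer v j * pochhammer w i * p * \<dots> = ?l"
    proof -
      have d: "Suc N - j = Suc i" "Suc N - Suc j = i" using N by auto
      have e: "pochhammer (c + of_nat (Suc j)) i = p" by (simp add: p_def algebra_simps)
      show ?thesis
        unfolding d s1 pochhammer_Suc[of w i] pochhammer_Suc[of u j] pochhammer_Suc[of v j] e
        by algebra
    qed
    finally show ?thesis by simp
  qed
  show ?thesis
    unfolding saal_def saal_contiguous_def sum_choose_Suc w_def[symmetric] sum_distrib_left sum.distrib[symmetric]
  proof (rule sum.cong, goal_cases)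
    case (2 j)
    then have "j \<le> N" by simp
    show ?case unfolding step[OF \<open>j \<le> N\<close>] by algebra
  qed simp
qed

text \<open>
  Here \<open>(w+1)_n - (w)_n = n (w+1)_{n-1}\<close> is applied in each term.
\<close>

lemma saal_shift:
  "saal u v (c + 1) (Suc M) =
    saal_contiguous u v c (Suc M) + of_nat (Suc M) * (c + of_nat (Suc M)) * saal u v (c + 1) M"
proof -
  define w where "w = c - u - v"
  have w1: "c + 1 - u - v = w + 1" by (simp add: w_def)
  have step: "of_nat (Suc M choose j) * (pochhammer u j * pochhammer v j *
        pochhammer (c + 1 + of_nat j) (Suc M - j) * pochhammer (w + 1) (Suc M - j)) =
      of_nat (Suc M choose j) * (pochhammer u j * pochhammer v j *
        pochhammer (c + 1 + of_nat j) (Suc M - j) * pochhammer w (Suc M - j)) +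
      of_nat (Suc M) * (c + of_nat (Suc M)) * (of_nat (M choose j) * (pochhammer u j * pochhammer v j *
        pochhammer (c + 1 + of_nat j) (M - j) * pochhammer (w + 1) (M - j)))" if jle: "j \<le> M" for j
  proof -
    obtain i where M: "M = j + i" using le_Suc_ex[OF jle] by blast
    have d: "Suc M - j = Suc i" "M - j = i" using M by auto
    have "(Suc M - j) * (Suc M choose j) = Suc M * (M choose j)"
      using binomial_absorb_comp[of "Suc M" j] by simp
    then have ch: "of_nat (Suc M) * (of_nat (M choose j) :: complex) =
        of_nat (Suc i) * of_nat (Suc M choose j)"
      unfolding d by (metis of_nat_mult)
    have w: "pochhammer (w + 1) (Suc i) = pochhammer w (Suc i) + of_nat (Suc i) * pochhammer (w + 1) i"
      unfolding pochhammer_rec[of w] pochhammer_Suc[of "w + 1"] by (simp add: algebra_simps)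
    have c: "pochhammer (c + 1 + of_nat j) (Suc i) =
        pochhammer (c + 1 + of_nat j) i * (c + of_nat (Suc M))"
      by (simp add: pochhammer_Suc M algebra_simps)
    have "of_nat (Suc M) * (c + of_nat (Suc M)) * (of_nat (M choose j) * (pochhammer u j * pochhammer v j *
        pochhammer (c + 1 + of_nat j) i * pochhammer (w + 1) i)) =
        (of_nat (Suc M) * of_nat (M choose j)) * (pochhammer u j * pochhammer v j *
        pochhammer (c + 1 + of_nat j) (Suc i) * pochhammer (w + 1) i)"
      unfolding c by (simp only: ac_simps)
    then show ?thesis unfolding d w ch by algebra
  qed
  show ?thesis
    unfolding saal_def saal_contiguous_def w1 w_def[symmetric] sum_distrib_left sum.atMost_Suc
    by (simp add: step sum.distrib del: of_nat_Suc)
qed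

text \<open>
  The theorem of Pfaff and Saalschuetz.  Eliminating the contiguous sum gives the recursion
  \<open>saal c (N+1) = (c-u)(c-v) saal (c+1) N\<close>, by induction on N for all c simultaneously; the product
  on the right-hand side satisfies the same recursion.
\<close>

lemma saalschuetz: "saal u v c N = pochhammer (c - u) N * pochhammer (c - v) N"
proof -
  have rec: "saal u v c (Suc N) = (c - u) * (c - v) * saal u v (c + 1) N" for c N
  proof (induction N arbitrary: c)
    case 0
    show ?case by (simp add: saal_def algebra_simps)
  next
    case (Suc M)
    show ?case unfolding saal_Suc[of u v c "Suc M"] saal_shift Suc
      by (simp only: distrib_left ac_simps)
  qed
  show ?thesis
  proof (induction N arbitrary: c)
    case 0
    show ?case by (simp add: saal_def)
  next
    case (Suc N)
    show ?case unfolding rec Suc pochhammer_rec by (simp add: algebra_simps)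
  qed
qed

section \<open>Euler and Whipple transformations\<close>

text \<open>
  The power series of \<open>(1 - X)^(-w)\<close>.
\<close>

definition binomial_fps :: "complex \<Rightarrow> complex fps" where
  "binomial_fps w = Abs_fps (\<lambda>n. pochhammer w n / fact n)"

lemma binomial_fps_add: "binomial_fps (w + w') = binomial_fps w * binomial_fps w'"
proof (rule fps_ext)
  fix n
  show "fps_nth (binomial_fps (w + w')) n = fps_nth (binomial_fps w * binomial_fps w') n"
    unfolding binomial_fps_def fps_mult_nth fps_nth_Abs_fps pochhammer_binomial_sum sum_divide_distrib
      atMost_atLeast0
    by (rule sum.cong) (simp_all add: binomial_fact)
qed

lemma binomial_fps_0: "binomial_fps 0 = 1"
  by (rule fps_ext) (simp add: binomial_fps_def pochhammer_0_left)

text \<open>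
  The Gauss series \<open>2F1(p, q; e + 1; X)\<close> divided by \<open>Gamma(e + 1)\<close>.  The division keeps the coefficients
  finite when the denominator parameter is an integer \<open>\<le> 0\<close>.
\<close>

definition hypergeom_fps :: "complex \<Rightarrow> complex \<Rightarrow> int \<Rightarrow> complex fps" where
  "hypergeom_fps p q e =
    Abs_fps (\<lambda>n. pochhammer p n * pochhammer q n / fact n * rfact (e + int n))"

text \<open>
  Comparing coefficients turns Euler's transformation into the theorem of Pfaff and Saalschuetz.
\<close>

lemma euler_transformation:
  "hypergeom_fps (of_int (e + 1) - u) (of_int (e + 1) - v) e =
    binomial_fps (of_int (e + 1) - u - v) * hypergeom_fps u v e"
proof (rule fps_ext)
  fix N
  define c where "c = (of_int (e + 1) :: complex)"
  have "fps_nth (hypergeom_fps (c - u) (c - v) e) N = saal u v c N / fact N * rfact (e + int N)"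
    by (simp add: hypergeom_fps_def saalschuetz)
  also have "\<dots> = (\<Sum>j\<le>N. pochhammer u j * pochhammer v j / fact j * rfact (e + int j) *
      (pochhammer (c - u - v) (N - j) / fact (N - j)))"
    unfolding saal_def sum_divide_distrib sum_distrib_right
  proof (rule sum.cong)
    fix j assume "j \<in> {..N}"
    then have j: "j \<le> N" by simp
    have "rfact (e + int j) = pochhammer (c + of_nat j) (N - j) * rfact (e + int N)"
      using rfact_pochhammer[of "e + int j" "N - j"] j by (simp add: c_def algebra_simps of_nat_diff)
    then show "of_nat (N choose j) * (pochhammer u j * pochhammer v j * pochhammer (c + of_nat j) (N - j) *
        pochhammer (c - u - v) (N - j)) / fact N * rfact (e + int N) =
        pochhammer u j * pochhammer v j / fact j * rfact (e + int j) *
        (pochhammer (c - u - v) (N - j) / fact (N - j))"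
      using j by (simp add: binomial_fact)
  qed simp
  also have "\<dots> = fps_nth (hypergeom_fps u v e * binomial_fps (c - u - v)) N"
    by (simp add: fps_mult_nth hypergeom_fps_def binomial_fps_def atMost_atLeast0)
  finally show "fps_nth (hypergeom_fps (of_int (e + 1) - u) (of_int (e + 1) - v) e) N =
      fps_nth (binomial_fps (of_int (e + 1) - u - v) * hypergeom_fps u v e) N"
    unfolding c_def by (simp add: mult.commute)
qed

text \<open>
  The powers of \<open>1 - X\<close> from two Euler transformations cancel.  A coefficient of such a product is, up to
  a factor, a terminating balanced 4F3, and equality of the coefficients on the two sides is Whipple's
  transformation.
\<close>

lemma hypergeom_fps_product:
  assumes "(of_int (e + 1) - u - v) + (of_int (e' + 1) - u' - v') = 0"
  shows "hypergeom_fps (of_int (e + 1) - u) (of_int (e + 1) - v) e *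
      hypergeom_fps (of_int (e' + 1) - u') (of_int (e' + 1) - v') e' =
    hypergeom_fps u v e * hypergeom_fps u' v' e'"
proof -
  have "binomial_fps (of_int (e + 1) - u - v) * binomial_fps (of_int (e' + 1) - u' - v') = 1"
    using assms by (simp only: binomial_fps_add[symmetric] binomial_fps_0)
  then show ?thesis
    unfolding euler_transformation by (metis (no_types, lifting) mult.assoc mult.commute mult.left_neutral)
qed

section \<open>Theta as the solution of a triangular system\<close>

lemma inverse_ifact: "i \<ge> 0 \<Longrightarrow> inverse (ifact i) = rfact i"
  by (simp add: ifact_def rfact_def divide_inverse)

lemma ifact_of_nat: "ifact (int n) = fact n"
  by (simp add: ifact_def)

text \<open>
  Of the four lower bounds for z in T2, \<open>al = a + b + c - r - s - k\<close> is taken as the origin.  One of the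
  upper bounds is then \<open>al + k\<close>, and the other five constraints are enforced by the zeros of the
  reciprocal factorial.
\<close>

lemma T2_shifted:
  fixes a b c r s k al :: nat
  assumes al: "int al = int a + int b + int c - int r - int s - int k"
  shows "T2 (int a) (int b) (int c) (int r) (int s) (int k) =
    (-1) ^ al * (\<Sum>j\<le>k. (-1) ^ j * fact (al + 1 + j) *
      (rfact (int c - int r - int s + int j) * rfact (int a - int s - int k + int j) *
       rfact (int r - int k + int j) * rfact (int j) * rfact (int k - int j) *
       rfact (int s - int j) * rfact (int b - int r - int j)))"
proof -
  let ?Z = "Z_range (int a) (int b) (int c) (int r) (int s) (int k)"
  define g where "g z = (-1) powi z * ifact (z + 1) *
    (rfact (z - int a - int b + int k) * rfact (z - int b - int c + int r) *
     rfact (z - int a - int b - int c + 2 * int r + int s) *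
     rfact (z - int a - int b - int c + int r + int s + int k) *
     rfact (int a + int b + int c - int r - int s - z) *
     rfact (int a + int b + int c - int r - int k - z) *
     rfact (int a + 2 * int b + int c - 2 * int r - int s - int k - z))" for z
  have "T2 (int a) (int b) (int c) (int r) (int s) (int k) = sum g ?Z"
    unfolding T2_def
    by (rule sum.cong) (auto simp: g_def Z_range_def inverse_mult_distrib inverse_ifact)
  also have "\<dots> = sum g {int al..int al + int k}"
  proof (rule sum.mono_neutral_left)
    show "?Z \<subseteq> {int al..int al + int k}"
      unfolding Z_range_def al by auto
    show "\<forall>z\<in>{int al..int al + int k} - ?Z. g z = 0"
      unfolding Z_range_def g_def rfact_def by auto
  qed simp
  also have "\<dots> = (\<Sum>j\<le>k. g (int al + int j))"
    by (rule sum.reindex_bij_witness[of _ "\<lambda>j. int al + int j" "\<lambda>z. nat (z - int al)"]) auto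
  also have "\<dots> = (\<Sum>j\<le>k. (-1) ^ al * ((-1) ^ j * fact (al + 1 + j) *
      (rfact (int c - int r - int s + int j) * rfact (int a - int s - int k + int j) *
       rfact (int r - int k + int j) * rfact (int j) * rfact (int k - int j) *
       rfact (int s - int j) * rfact (int b - int r - int j))))"
  proof (rule sum.cong)
    fix j
    have "(-1) powi (int al + int j) = ((-1) ^ (al + j) :: complex)"
      by (metis of_nat_add power_int_of_nat)
    moreover have "ifact (int al + int j + 1) = fact (al + 1 + j)"
      by (metis (no_types, lifting) ifact_of_nat of_nat_1 of_nat_add add.assoc add.commute)
    ultimately have "g (int al + int j) = (-1) ^ (al + j) * fact (al + 1 + j) *
      (rfact (int c - int r - int s + int j) * rfact (int a - int s - int k + int j) *
       rfact (int r - int k + int j) * rfact (int j) * rfact (int k - int j) *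
       rfact (int s - int j) * rfact (int b - int r - int j))"
      unfolding g_def al by (simp add: algebra_simps del: rfact_of_nat)
    then show "g (int al + int j) = (-1) ^ al * ((-1) ^ j * fact (al + 1 + j) *
      (rfact (int c - int r - int s + int j) * rfact (int a - int s - int k + int j) *
       rfact (int r - int k + int j) * rfact (int j) * rfact (int k - int j) *
       rfact (int s - int j) * rfact (int b - int r - int j)))"
      by (simp only: power_add mult.assoc)
  qed simp
  finally show ?thesis by (simp only: sum_distrib_left)
qed

text \<open>
  Both sums are coefficients of \<open>X^k\<close> in products of two Gauss series.  In
  \<open>hypergeom_fps_product\<close> the choice is \<open>e = c - r - s\<close>, \<open>u = -(b - r)\<close>, \<open>v = al + 2\<close> for the first factor and
  \<open>e' = s - k\<close>, \<open>u' = -r\<close>, \<open>v' = -(a - s)\<close> for the second.  The right-hand side has the factorials of T2; the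
  left-hand side has those that come from inverting a triangular matrix.
\<close>

lemma racah_sum_transformation:
  fixes a b c r s k al :: nat
  assumes "r \<le> b" "r \<le> c" "s \<le> a" "s \<le> b + c - 2 * r"
    and "k \<le> a" "k \<le> b" "k + r + s \<le> a + b" "k \<le> r + s"
    and al: "al = a + b + c - r - s - k"
  shows "fact (a + b + 1 - k) / (fact (b + c - 2 * r - s) * fact (r + s - k) * fact (a - k)) *
      (\<Sum>m\<le>k. (-1) ^ m * fact (b + c - 2 * r - s + m) * fact (r + s - m) * fact (a - m) *
        (rfact (int c - int r - int s + int m) * rfact (int s - int m) *
         rfact (int (a + b + 1 - k) - int m)) / (fact m * fact (k - m))) =
    fact (b - r) * fact r * fact (a - s) / fact (al + 1) *
      (\<Sum>j\<le>k. (-1) ^ j * fact (al + 1 + j) *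
      (rfact (int c - int r - int s + int j) * rfact (int a - int s - int k + int j) *
       rfact (int r - int k + int j) * rfact (int j) * rfact (int k - int j) *
       rfact (int s - int j) * rfact (int b - int r - int j)))"
    (is "?K1 * (\<Sum>m\<le>k. ?f m) = ?K2 * (\<Sum>j\<le>k. ?g j)")
proof -
  define P where "P = b + c - 2 * r - s"
  define T where "T = a + b + 1 - k"
  define e where "e = int c - int r - int s"
  define e' where "e' = int s - int k"
  have ints: "int P = int b + int c - 2 * int r - int s" "int T = int a + int b + 1 - int k"
    "int al = int a + int b + int c - int r - int s - int k"
    using assms by (auto simp: P_def T_def)
  have c1: "of_int (e + 1) - (- of_nat (b - r)) = (of_nat P + 1 :: complex)"
  proof -
    have "e + 1 + int (b - r) = int P + 1" using assms(1) ints by (simp add: e_def of_nat_diff)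
    from arg_cong[OF this, of "of_int :: int \<Rightarrow> complex"] show ?thesis by simp
  qed
  have c2: "of_int (e + 1) - (of_nat (al + 1) + 1) = (- of_nat T :: complex)"
  proof -
    have "e + 1 - (int (al + 1) + 1) = - int T" using ints by (simp add: e_def)
    from arg_cong[OF this, of "of_int :: int \<Rightarrow> complex"] show ?thesis by simp
  qed
  have c3: "of_int (e' + 1) - (- of_nat r) = (of_nat (r + s - k) + 1 :: complex)"
  proof -
    have "e' + 1 + int r = int (r + s - k) + 1" using assms(8) by (simp add: e'_def of_nat_diff)
    from arg_cong[OF this, of "of_int :: int \<Rightarrow> complex"] show ?thesis by simp
  qed
  have c4: "of_int (e' + 1) - (- of_nat (a - s)) = (of_nat (a - k) + 1 :: complex)"
  proof -
    have "e' + 1 + int (a - s) = int (a - k) + 1" using assms(3,5) by (simp add: e'_def of_nat_diff)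
    from arg_cong[OF this, of "of_int :: int \<Rightarrow> complex"] show ?thesis by simp
  qed
  \<comment> \<open>The exponents of 1 - X are opposite: \<open>r + a - k + 1\<close> and its negative.\<close>
  have bal: "(of_int (e + 1) - (- of_nat (b - r)) - (of_nat (al + 1) + 1)) +
      (of_int (e' + 1) - (- of_nat r) - (- of_nat (a - s))) = (0 :: complex)"
  proof -
    have "(e + 1 - (- int (b - r)) - (int (al + 1) + 1)) +
      (e' + 1 - (- int r) - (- int (a - s))) = 0"
      using assms(1,3) ints by (simp add: e_def e'_def of_nat_diff)
    from arg_cong[OF this, of "of_int :: int \<Rightarrow> complex"] show ?thesis by simp
  qed
  have eq: "hypergeom_fps (of_nat P + 1) (- of_nat T) e *
      hypergeom_fps (of_nat (r + s - k) + 1) (of_nat (a - k) + 1) e' =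
    hypergeom_fps (- of_nat (b - r)) (of_nat (al + 1) + 1) e *
      hypergeom_fps (- of_nat r) (- of_nat (a - s)) e'"
    using hypergeom_fps_product[OF bal] unfolding c1 c2 c3 c4 .
  have L: "fps_nth (hypergeom_fps (of_nat P + 1) (- of_nat T) e) m *
      fps_nth (hypergeom_fps (of_nat (r + s - k) + 1) (of_nat (a - k) + 1) e') (k - m) = ?K1 * ?f m"
    if "m \<le> k" for m
  proof -
    have d: "r + s - k + (k - m) = r + s - m" "a - k + (k - m) = a - m" "e' + int (k - m) = int s - int m"
      using that assms(5,8) by (auto simp: e'_def)
    show ?thesis
      unfolding hypergeom_fps_def fps_nth_Abs_fps pochhammer_pos_nat pochhammer_neg_nat d
      by (simp add: e_def P_def T_def mult_ac)
  qed
  have R: "fps_nth (hypergeom_fps (- of_nat (b - r)) (of_nat (al + 1) + 1) e) j *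
      fps_nth (hypergeom_fps (- of_nat r) (- of_nat (a - s)) e') (k - j) = ?K2 * ?g j"
    if "j \<le> k" for j
  proof -
    have d: "e' + int (k - j) = int s - int j" "int r - int (k - j) = int r - int k + int j"
      "int (a - s) - int (k - j) = int a - int s - int k + int j"
      "int (b - r) - int j = int b - int r - int j"
      "rfact (int k - int j) = 1 / fact (k - j)"
      using that assms(1,3) by (auto simp: e'_def rfact_def nat_diff_distrib)
    \<comment> \<open>Both numerator parameters of the second series are negative, so their signs cancel.\<close>
    have sq: "(-1) ^ (k - j) * ((-1) ^ (k - j) * z) = z" for z :: complex
      by (simp flip: mult.assoc power_mult_distrib)
    show ?thesis
      unfolding hypergeom_fps_def fps_nth_Abs_fps pochhammer_pos_nat pochhammer_neg_nat d
      by (simp add: e_def mult_ac sq)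
  qed
  have "?K1 * (\<Sum>m\<le>k. ?f m) = fps_nth (hypergeom_fps (of_nat P + 1) (- of_nat T) e *
      hypergeom_fps (of_nat (r + s - k) + 1) (of_nat (a - k) + 1) e') k"
    unfolding fps_mult_nth sum_distrib_left atMost_atLeast0 by (rule sum.cong) (simp_all only: L atLeastAtMost_iff)
  also have "\<dots> = ?K2 * (\<Sum>j\<le>k. ?g j)"
    unfolding eq fps_mult_nth sum_distrib_left atMost_atLeast0 by (rule sum.cong) (simp_all only: R atLeastAtMost_iff)
  finally show ?thesis .
qed

text \<open>
  The coefficient of \<open>z^m x^(r+s-m)\<close> in the polynomial to which \<open>(A, (B, C)_r)_s\<close> reduces for powers of
  linear forms; see \<open>right_expansion_scale\<close>.
\<close>

definition right_coeff :: "nat \<Rightarrow> nat \<Rightarrow> nat \<Rightarrow> nat \<Rightarrow> nat \<Rightarrow> complex" where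
  "right_coeff b c r s m =
    (if m \<le> s then of_nat ((c - r) choose (s - m)) * of_nat ((b + c - 2 * r - s + m) choose m) /
       of_nat ((b + c - 2 * r) choose s) else 0)"

text \<open>
  The inverse of the unitriangular matrix \<open>left_coeff a b n\<close>, as \<open>inv_left_inverse\<close> shows.
\<close>

definition inv_coeff :: "nat \<Rightarrow> nat \<Rightarrow> nat \<Rightarrow> nat \<Rightarrow> nat \<Rightarrow> complex" where
  "inv_coeff a b n m k =
    (-1) ^ (k - m) * of_nat ((n - m) choose (k - m)) * of_nat ((a - m) choose (k - m)) /
      of_nat ((a + b + 1 - m - k) choose (k - m))"

lemma right_inv_factorials:
  assumes "r \<le> b" "r \<le> c" "s \<le> a" "s \<le> b + c - 2 * r"
    and "k \<le> a" "k \<le> b" "k \<le> r + s" "m \<le> k"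
  shows "right_coeff b c r s m * inv_coeff a b (r + s) m k =
    fact s * fact (c - r) * fact (a + b + 1 - 2 * k) /
      (fact (b + c - 2 * r) * fact (r + s - k) * fact (a - k)) * (-1) ^ k *
    ((-1) ^ m * fact (b + c - 2 * r - s + m) * fact (r + s - m) * fact (a - m) *
        (rfact (int c - int r - int s + int m) * rfact (int s - int m) *
         rfact (int (a + b + 1 - k) - int m)) / (fact m * fact (k - m)))"
proof (cases "m \<le> s \<and> s - m \<le> c - r")
  case True
  have i: "int c - int r - int s + int m = int (c - r - (s - m))" "int s - int m = int (s - m)"
    "int (a + b + 1 - k) - int m = int (a + b + 1 - m - k)"
    using True assms by auto
  have d: "r + s - m - (k - m) = r + s - k" "a - m - (k - m) = a - k"
    "a + b + 1 - m - k - (k - m) = a + b + 1 - 2 * k" "(-1) ^ (k - m) = (-1) ^ k * ((-1) ^ m :: complex)"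
    using assms by (auto simp: power_diff_conv_inverse mult_2)
  have outer: "right_coeff b c r s m =
      fact (c - r) / (fact (s - m) * fact (c - r - (s - m))) *
      (fact (b + c - 2 * r - s + m) / (fact m * fact (b + c - 2 * r - s))) /
      (fact (b + c - 2 * r) / (fact s * fact (b + c - 2 * r - s)))"
    using True assms by (simp add: right_coeff_def binomial_fact)
  have inv: "inv_coeff a b (r + s) m k = (-1) ^ k * (-1) ^ m *
      (fact (r + s - m) / (fact (k - m) * fact (r + s - k))) *
      (fact (a - m) / (fact (k - m) * fact (a - k))) /
      (fact (a + b + 1 - m - k) / (fact (k - m) * fact (a + b + 1 - 2 * k)))"
    using assms by (simp add: inv_coeff_def binomial_fact d mult_2)
  show ?thesis
    unfolding i rfact_of_nat outer inv by (simp add: field_simps)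
next
  case False
  then show ?thesis
    using assms by (auto simp: right_coeff_def rfact_def binomial_eq_0)
qed

text \<open>
  The sum on the right is the solution of the triangular system.  If \<open>c + k < r + s\<close>, both
  sides are zero, since then \<open>right_coeff\<close> vanishes at all \<open>m \<le> k\<close>.
\<close>

lemma theta_eq_sum:
  assumes "r \<le> b" "r \<le> c" "s \<le> a" "s \<le> b + c - 2 * r"
    and "k \<le> a" "k \<le> b" "k + r + s \<le> a + b" "k \<le> r + s"
  shows "theta (int a) (int b) (int c) (int r) (int s) (int k) =
    (\<Sum>m\<le>k. right_coeff b c r s m * inv_coeff a b (r + s) m k)"
proof (cases "r + s \<le> c + k")
  case False
  have "right_coeff b c r s m = 0" if "m \<le> k" for m
    using False that assms by (auto simp: right_coeff_def binomial_eq_0)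
  then show ?thesis using False by (simp add: theta_def K_range_def)
next
  case True
  define al where "al = a + b + c - r - s - k"
  define S where "S = (\<Sum>j\<le>k. (-1) ^ j * fact (al + 1 + j) *
      (rfact (int c - int r - int s + int j) * rfact (int a - int s - int k + int j) *
       rfact (int r - int k + int j) * rfact (int j) * rfact (int k - int j) *
       rfact (int s - int j) * rfact (int b - int r - int j)))"
  define S' where "S' = (\<Sum>m\<le>k. (-1) ^ m * fact (b + c - 2 * r - s + m) * fact (r + s - m) * fact (a - m) *
        (rfact (int c - int r - int s + int m) * rfact (int s - int m) *
         rfact (int (a + b + 1 - k) - int m)) / (fact m * fact (k - m)))"
  have tr: "fact (a + b + 1 - k) / (fact (b + c - 2 * r - s) * fact (r + s - k) * fact (a - k)) * S' =
      fact (b - r) * fact r * fact (a - s) / fact (al + 1) * S"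
    unfolding S_def S'_def by (rule racah_sum_transformation[OF assms al_def])
  have al: "int al = int a + int b + int c - int r - int s - int k"
    using assms by (simp add: al_def)
  have T2: "T2 (int a) (int b) (int c) (int r) (int s) (int k) = (-1) ^ al * S"
    unfolding S_def by (rule T2_shifted[OF al])
  have T1: "T1 (int a) (int b) (int c) (int r) (int s) = fact r * fact (b - r) * fact (c - r) *
      fact s * fact (a - s) * fact (b + c - 2 * r - s) / fact (b + c - 2 * r)"
  proof -
    have "int b - int r = int (b - r)" "int c - int r = int (c - r)" "int a - int s = int (a - s)"
      "int b + int c - 2 * int r - int s = int (b + c - 2 * r - s)"
      "int b + int c - 2 * int r = int (b + c - 2 * r)"
      using assms by auto
    then show ?thesis unfolding T1_def by (simp only: ifact_of_nat)
  qed
  have F: "ifact (int a + int b - 2 * int k + 1) = fact (a + b + 1 - 2 * k)"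
    "ifact (int a + int b - int k + 1) = fact (a + b + 1 - k)"
    "ifact (int a + int b + int c - int r - int s - int k + 1) = fact (al + 1)"
  proof -
    have "int a + int b - 2 * int k + 1 = int (a + b + 1 - 2 * k)"
      "int a + int b - int k + 1 = int (a + b + 1 - k)"
      "int a + int b + int c - int r - int s - int k + 1 = int (al + 1)"
      using assms al by auto
    then show "ifact (int a + int b - 2 * int k + 1) = fact (a + b + 1 - 2 * k)"
      "ifact (int a + int b - int k + 1) = fact (a + b + 1 - k)"
      "ifact (int a + int b + int c - int r - int s - int k + 1) = fact (al + 1)"
      by (simp_all only: ifact_of_nat)
  qed
  have sgn: "(-1) powi (int a + int b + int c + int r + int s) * (-1) ^ al = ((-1) ^ k :: complex)"
  proof -
    have "int (a + b + c + r + s + al) = int (k + 2 * (r + s + al))"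
      using al by simp
    then have parity: "a + b + c + r + s + al = k + 2 * (r + s + al)"
      by (simp only: of_nat_eq_iff)
    have "(-1) powi (int a + int b + int c + int r + int s) = ((-1) ^ (a + b + c + r + s) :: complex)"
      by (metis of_nat_add power_int_of_nat)
    then have "(-1) powi (int a + int b + int c + int r + int s) * (-1) ^ al =
        ((-1) ^ (k + 2 * (r + s + al)) :: complex)"
      unfolding parity[symmetric] by (simp only: power_add)
    then show ?thesis by (simp add: power_add power_mult)
  qed
  have K: "int k \<in> K_range (int a) (int b) (int c) (int r) (int s)"
    using assms True by (auto simp: K_range_def)
  have "theta (int a) (int b) (int c) (int r) (int s) (int k) =
      ((-1) powi (int a + int b + int c + int r + int s) * (-1) ^ al) *
      (fact (c - r) * fact s * fact (b + c - 2 * r - s) / fact (b + c - 2 * r) *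
      fact (a + b + 1 - 2 * k) / fact (a + b + 1 - k)) *
      (fact (b - r) * fact r * fact (a - s) / fact (al + 1) * S)"
    using K unfolding theta_def T1 T2 F by (simp add: field_simps)
  also have "\<dots> = fact s * fact (c - r) * fact (a + b + 1 - 2 * k) /
      (fact (b + c - 2 * r) * fact (r + s - k) * fact (a - k)) * (-1) ^ k * S'"
    unfolding sgn tr[symmetric] by (simp add: field_simps)
  also have "\<dots> = (\<Sum>m\<le>k. right_coeff b c r s m * inv_coeff a b (r + s) m k)"
    unfolding S'_def sum_distrib_left using assms
    by (intro sum.cong refl right_inv_factorials[symmetric]) auto
  finally show ?thesis .
qed

section \<open>Expansions in monomials\<close>

text \<open>
  By \<open>(P choose j)(j choose l) = (P choose l)(P - l choose j - l)\<close> the sum becomes Vandermonde's.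
\<close>

lemma Vandermonde_with_binomial_weight:
  assumes "l \<le> q"
  shows "(\<Sum>j\<le>q. (P choose j) * (Q choose (q - j)) * (j choose l)) =
    (P choose l) * ((P + Q - l) choose (q - l))"
proof (cases "l \<le> P")
  case False
  then have "(P choose j) * (Q choose (q - j)) * (j choose l) = 0" for j
    by (cases "j < l") (auto simp: binomial_eq_0)
  then show ?thesis using False by (simp add: binomial_eq_0)
next
  case lP: True
  have "(\<Sum>j\<le>q. (P choose j) * (Q choose (q - j)) * (j choose l)) =
      (\<Sum>j\<in>{l..q}. (P choose j) * (Q choose (q - j)) * (j choose l))"
    by (rule sum.mono_neutral_right) (auto simp: binomial_eq_0)
  also have "\<dots> = (\<Sum>i\<le>q - l. (P choose (i + l)) * (Q choose (q - (i + l))) * ((i + l) choose l))"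
    using assms by (intro sum.reindex_bij_witness[of _ "\<lambda>i. i + l" "\<lambda>j. j - l"]) auto
  also have "\<dots> = (\<Sum>i\<le>q - l. (P choose l) * (((P - l) choose i) * (Q choose (q - l - i))))"
  proof (rule sum.cong)
    fix i assume "i \<in> {..q - l}"
    have "(P choose (i + l)) * ((i + l) choose l) = (P choose l) * ((P - l) choose i)"
    proof (cases "i + l \<le> P")
      case True
      then show ?thesis using choose_mult[of l "i + l" P] by simp
    next
      case False
      then have "(P choose (i + l)) = 0" "((P - l) choose i) = 0"
        using lP by (auto intro!: binomial_eq_0)
      then show ?thesis by (simp only: mult_0 mult_0_right)
    qed
    then show "(P choose (i + l)) * (Q choose (q - (i + l))) * ((i + l) choose l) =
        (P choose l) * (((P - l) choose i) * (Q choose (q - l - i)))"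
      by (simp add: mult_ac add.commute)
  qed simp
  also have "\<dots> = (P choose l) * ((P - l + Q) choose (q - l))"
    by (simp only: vandermonde sum_distrib_left[symmetric])
  finally show ?thesis using lP by simp
qed

text \<open>
  For powers of linear forms, nested transvectants of either kind lead to sums of the form on the
  left.  Expanding \<open>(x + z)^j\<close> leaves a Vandermonde sum for each coefficient.
\<close>

lemma binomial_pair_expansion:
  fixes x z :: "'a::comm_semiring_1"
  shows "(\<Sum>j\<le>q. of_nat ((P choose j) * (Q choose (q - j))) * ((x + z) ^ j * x ^ (q - j))) =
    (\<Sum>l\<le>q. of_nat ((P choose l) * ((P + Q - l) choose (q - l))) * (z ^ l * x ^ (q - l)))"
proof -
  have binom: "(x + z) ^ j * x ^ (q - j) = (\<Sum>l\<le>q. of_nat (j choose l) * (z ^ l * x ^ (q - l)))"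
    if "j \<le> q" for j
  proof -
    have "(x + z) ^ j * x ^ (q - j) = (\<Sum>l\<le>j. of_nat (j choose l) * (z ^ l * x ^ (j - l))) * x ^ (q - j)"
      by (simp add: add.commute[of x] binomial_ring mult.assoc)
    also have "\<dots> = (\<Sum>l\<le>j. of_nat (j choose l) * (z ^ l * x ^ (q - l)))"
      unfolding sum_distrib_right
    proof (rule sum.cong)
      fix l assume "l \<in> {..j}"
      then have "q - l = (j - l) + (q - j)" using that by auto
      then show "of_nat (j choose l) * (z ^ l * x ^ (j - l)) * x ^ (q - j) =
          of_nat (j choose l) * (z ^ l * x ^ (q - l))"
        by (simp add: power_add mult.assoc)
    qed simp
    also have "\<dots> = (\<Sum>l\<le>q. of_nat (j choose l) * (z ^ l * x ^ (q - l)))"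
      using that by (intro sum.mono_neutral_left) (auto simp: binomial_eq_0)
    finally show ?thesis .
  qed
  have "(\<Sum>j\<le>q. of_nat ((P choose j) * (Q choose (q - j))) * ((x + z) ^ j * x ^ (q - j))) =
      (\<Sum>j\<le>q. \<Sum>l\<le>q. of_nat ((P choose j) * (Q choose (q - j)) * (j choose l)) * (z ^ l * x ^ (q - l)))"
  proof (rule sum.cong)
    fix j assume "j \<in> {..q}"
    then show "of_nat ((P choose j) * (Q choose (q - j))) * ((x + z) ^ j * x ^ (q - j)) =
        (\<Sum>l\<le>q. of_nat ((P choose j) * (Q choose (q - j)) * (j choose l)) * (z ^ l * x ^ (q - l)))"
      using binom[of j] by (simp add: sum_distrib_left mult.assoc)
  qed simp
  also have "\<dots> = (\<Sum>l\<le>q. of_nat (\<Sum>j\<le>q. (P choose j) * (Q choose (q - j)) * (j choose l)) *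
      (z ^ l * x ^ (q - l)))"
    by (subst sum.swap) (simp add: of_nat_sum sum_distrib_right)
  also have "\<dots> = (\<Sum>l\<le>q. of_nat ((P choose l) * ((P + Q - l) choose (q - l))) * (z ^ l * x ^ (q - l)))"
    by (rule sum.cong) (simp_all only: Vandermonde_with_binomial_weight atMost_iff)
  finally show ?thesis .
qed

text \<open>
  The coefficient of \<open>z^l x^(n-l)\<close> in the polynomial to which \<open>((A, B)_k, C)_{n-k}\<close> reduces for powers of
  linear forms; see \<open>left_expansion_scale\<close>.
\<close>

definition left_coeff :: "nat \<Rightarrow> nat \<Rightarrow> nat \<Rightarrow> nat \<Rightarrow> nat \<Rightarrow> complex" where
  "left_coeff a b n k l =
    (if k \<le> l then of_nat ((a - k) choose (l - k)) * of_nat ((a + b - k - l) choose (n - l)) /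
       of_nat ((a + b - 2 * k) choose (n - k)) else 0)"

section \<open>Inversion of the triangular matrix\<close>

text \<open>
  The sum telescopes: its i-th partial sum is
  \<open>(-1)^i (q-1 choose i) (N-i-q)! / (N-i)!\<close>, and this vanishes at \<open>i = q\<close>.
\<close>

lemma alternating_sum_zero:
  assumes "0 < q" "2 * q \<le> N"
  shows "(\<Sum>p\<le>q. (-1) ^ p * of_nat (q choose p) * of_nat (N + 1 - 2 * p) *
    fact (N - p - q) / fact (N + 1 - p)) = (0 :: complex)"
proof -
  obtain Q where q: "q = Suc Q" using assms gr0_implies_Suc by blast
  define U where "U p = (-1) ^ p * of_nat (Q choose p) * fact (N - p - q) / (fact (N - p) :: complex)" for p
  have "(\<Sum>p\<le>i. (-1) ^ p * of_nat (q choose p) * of_nat (N + 1 - 2 * p) *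
    fact (N - p - q) / fact (N + 1 - p)) = U i" if "i \<le> q" for i
    using that
  proof (induction i)
    case 0
    then show ?case by (simp add: U_def divide_simps del: of_nat_Suc)
  next
    case (Suc i)
    obtain d where d: "Q = i + d" using Suc.prems q le_Suc_ex by auto
    obtain M where M: "N = 2 * q + M" using assms le_Suc_ex by auto
    have nats: "Suc (i + 2 * d + 1 + M) - q = Suc (d + M)" "N - i = Suc (i + 2 * d + 1 + M)"
      "i + 2 * d + 1 + M - q = d + M" "N + 1 - Suc i = Suc (i + 2 * d + 1 + M)" "N - Suc i = i + 2 * d + 1 + M"
      "N + 1 - 2 * Suc i = 2 * d + 1 + M"
      unfolding M q d by auto
    have "Suc i * (Q choose Suc i) = (Q choose i) * d"
      using binomial_absorb_comp[of Q i] binomial_absorption[of i Q] d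
      by (metis Suc_times_binomial_eq add_diff_cancel_left' binomial_absorb_comp mult.commute
          Suc_times_binomial_add binomial_symmetric)
    then have ab: "(of_nat i + 1) * of_nat (Q choose Suc i) = (of_nat (Q choose i) * of_nat d :: complex)"
      by (metis of_nat_Suc of_nat_mult add.commute)
    define F where "F = (fact (i + 2 * d + 1 + M) :: complex)"
    define y where "y = (of_nat (Suc (i + 2 * d + 1 + M)) :: complex)"
    have F: "F \<noteq> 0" "fact (Suc (i + 2 * d + 1 + M)) = y * F" "y \<noteq> 0"
      unfolding F_def y_def by (simp_all del: of_nat_Suc)
    have yv: "y = of_nat i + 2 * of_nat d + of_nat M + 2"
      by (simp add: y_def)
    define A where "A = (-1) ^ i * fact (d + M) / (y * F)"
    have u: "U i = A * (of_nat (Q choose i) * (of_nat d + of_nat M + 1))"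
      unfolding U_def nats(1) nats(2) F(2) A_def fact_Suc[of "d + M"] by (simp add: add_ac)
    have t: "(-1) ^ Suc i * of_nat (q choose Suc i) * of_nat (N + 1 - 2 * Suc i) *
        fact (N - Suc i - q) / fact (N + 1 - Suc i) =
        - A * ((of_nat (Q choose i) + of_nat (Q choose Suc i)) * (2 * of_nat d + 1 + of_nat M))"
      unfolding nats F(2) A_def by (simp add: q)
    have "(\<Sum>p\<le>Suc i. (-1) ^ p * of_nat (q choose p) * of_nat (N + 1 - 2 * p) *
        fact (N - p - q) / fact (N + 1 - p)) =
        A * (of_nat (Q choose i) * (of_nat d + of_nat M + 1) -
          (of_nat (Q choose i) + of_nat (Q choose Suc i)) * (2 * of_nat d + 1 + of_nat M))"
      unfolding sum.atMost_Suc using Suc u t by (simp add: right_diff_distrib)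
    also have "of_nat (Q choose i) * (of_nat d + of_nat M + 1) -
          (of_nat (Q choose i) + of_nat (Q choose Suc i)) * (2 * of_nat d + 1 + of_nat M) =
        - of_nat (Q choose Suc i) * y"
      unfolding yv using ab by algebra
    also have "A * (- of_nat (Q choose Suc i) * y) = U (Suc i)"
      unfolding U_def nats A_def using F by (simp add: F_def)
    finally show ?case .
  qed
  from this[of q] show ?thesis by (simp add: U_def q)
qed

text \<open>
  In the product the factors that depend on k combine to the summand of \<open>alternating_sum_zero\<close> with
  \<open>p = k - m\<close>, \<open>q = l - m\<close> and \<open>N = a + b - 2 m\<close>.
\<close>

lemma inv_left_factorials:
  assumes "m \<le> k" "k \<le> l" "l \<le> a" "l \<le> b" "l \<le> n" "n + l \<le> a + b"
  shows "inv_coeff a b n m k * left_coeff a b n k l =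
    fact (n - m) * fact (a - m) / (fact (l - m) * fact (a - l) * fact (n - l)) *
    ((-1) ^ (k - m) * of_nat ((l - m) choose (k - m)) * of_nat (a + b - 2 * m + 1 - 2 * (k - m)) *
      fact (a + b - 2 * m - (k - m) - (l - m)) / fact (a + b - 2 * m + 1 - (k - m)))"
proof -
  have nats: "n - m - (k - m) = n - k" "a - m - (k - m) = a - k" "a - k - (l - k) = a - l"
    "l - m - (k - m) = l - k" "a + b + 1 - m - k - (k - m) = Suc (a + b - 2 * k)"
    "a + b - 2 * m + 1 - 2 * (k - m) = Suc (a + b - 2 * k)"
    "a + b - 2 * m - (k - m) - (l - m) = a + b - k - l"
    "a + b - 2 * m + 1 - (k - m) = a + b + 1 - m - k"
    "a + b - k - l - (n - l) = a + b - k - n" "a + b - 2 * k - (n - k) = a + b - k - n"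
    using assms by auto
  have le: "k - m \<le> n - m" "k - m \<le> a - m" "k - m \<le> a + b + 1 - m - k" "l - k \<le> a - k"
    "n - l \<le> a + b - k - l" "n - k \<le> a + b - 2 * k" "k - m \<le> l - m"
    using assms by auto
  show ?thesis
    unfolding inv_coeff_def left_coeff_def binomial_fact[OF le(1)] binomial_fact[OF le(2)]
      binomial_fact[OF le(3)] binomial_fact[OF le(4)] binomial_fact[OF le(5)] binomial_fact[OF le(6)]
      binomial_fact[OF le(7)] nats fact_Suc[of "a + b - 2 * k"]
    using assms by (simp add: divide_simps del: of_nat_Suc)
qed

lemma inv_left_inverse:
  assumes "m \<le> l" "l \<le> a" "l \<le> b" "l \<le> n" "n + l \<le> a + b"
  shows "(\<Sum>k\<in>{m..l}. inv_coeff a b n m k * left_coeff a b n k l) = (if m = l then 1 else 0)"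
proof (cases "m = l")
  case True
  then show ?thesis using assms by (simp add: inv_coeff_def left_coeff_def mult_2)
next
  case False
  let ?K = "fact (n - m) * fact (a - m) / (fact (l - m) * fact (a - l) * fact (n - l)) :: complex"
  let ?t = "\<lambda>p. (-1) ^ p * of_nat ((l - m) choose p) * of_nat (a + b - 2 * m + 1 - 2 * p) *
      fact (a + b - 2 * m - p - (l - m)) / fact (a + b - 2 * m + 1 - p) :: complex"
  have "(\<Sum>k\<in>{m..l}. inv_coeff a b n m k * left_coeff a b n k l) = (\<Sum>k\<in>{m..l}. ?K * ?t (k - m))"
    using assms by (intro sum.cong refl inv_left_factorials) auto
  also have "\<dots> = (\<Sum>p\<le>l - m. ?K * ?t p)"
    using assms by (intro sum.reindex_bij_witness[of _ "\<lambda>p. p + m" "\<lambda>k. k - m"]) auto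
  also have "\<dots> = 0"
    unfolding sum_distrib_left[symmetric] using False assms
    by (subst alternating_sum_zero) auto
  finally show ?thesis using False by simp
qed

text \<open>
  The bounds on l are the upper bounds on k in \<open>K_range\<close>; under them no denominator of the
  triangular system vanishes, and the system can be solved.
\<close>

lemma coefficient_identity_low:
  assumes rs: "r \<le> b" "r \<le> c" "s \<le> a" "s \<le> b + c - 2 * r"
    and l: "l \<le> a" "l \<le> b" "r + s + l \<le> a + b" "l \<le> r + s"
  shows "(\<Sum>k\<le>l. theta (int a) (int b) (int c) (int r) (int s) (int k) * left_coeff a b (r + s) k l) =
    right_coeff b c r s l"
proof -
  let ?L = "right_coeff b c r s" and ?M = "inv_coeff a b (r + s)" and ?R = "left_coeff a b (r + s)"
  have "(\<Sum>k\<le>l. theta (int a) (int b) (int c) (int r) (int s) (int k) * ?R k l) =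
      (\<Sum>k\<le>l. \<Sum>m\<le>k. ?L m * (?M m k * ?R k l))"
    using rs l by (intro sum.cong refl, subst theta_eq_sum) (auto simp: sum_distrib_right mult.assoc)
  also have "\<dots> = (\<Sum>m\<le>l. \<Sum>k\<in>{m..l}. ?L m * (?M m k * ?R k l))"
    unfolding sum.Sigma[OF finite_atMost ballI[OF finite_atMost]]
      sum.Sigma[OF finite_atMost ballI[OF finite_atLeastAtMost]]
    by (rule sum.reindex_bij_witness[of _ "\<lambda>(m, k). (k, m)" "\<lambda>(k, m). (m, k)"]) auto
  also have "\<dots> = (\<Sum>m\<le>l. ?L m * (if m = l then 1 else 0))"
    unfolding sum_distrib_left[symmetric] using l
    by (intro sum.cong refl, subst inv_left_inverse) auto
  also have "\<dots> = (\<Sum>m\<le>l. if m = l then ?L l else 0)"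
    by (intro sum.cong) auto
  also have "\<dots> = ?L l"
    by simp
  finally show ?thesis .
qed

section \<open>All coefficients from the low ones\<close>

text \<open>
  Counting zeros: the hypotheses give a zero of order at least p at 0 and of order at least q at -1.
\<close>

lemma poly_eq_0_by_roots:
  fixes D :: "complex poly"
  assumes "\<And>i. i < p \<Longrightarrow> coeff D i = 0" and "[:1, 1:] ^ q dvd D" and "degree D < p + q"
  shows "D = 0"
proof (rule ccontr)
  assume D: "D \<noteq> 0"
  have "monom 1 p dvd D" using assms(1) by (simp add: monom_1_dvd_iff')
  then obtain E where E: "D = monom 1 p * E" by (elim dvdE)
  have "q \<le> order (-1) D"
    using assms(2) D order_divides[of "-1" q D] by simp
  also have "order (-1) D = order (-1) E"
  proof -
    have "order (-1) (monom 1 p :: complex poly) = 0"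
      by (rule order_0I) (simp add: poly_monom)
    then show ?thesis using D E by (simp add: order_mult)
  qed
  also have "\<dots> \<le> degree E" using D E by (intro order_degree) auto
  finally have "p + q \<le> degree D"
    using D E by (simp add: degree_mult_eq degree_monom_eq)
  then show False using assms(3) by simp
qed

text \<open>
  This is \<open>binomial_pair_expansion\<close> with x and z exchanged and the summation reversed.
\<close>

lemma right_expansion:
  fixes x z :: "'a::comm_semiring_1"
  assumes "r \<le> b" "r \<le> c" "s \<le> b + c - 2 * r"
  shows "(\<Sum>j\<le>s. of_nat (((b - r) choose j) * ((c - r) choose (s - j))) * (z ^ j * (x + z) ^ (s - j))) =
    (\<Sum>m\<le>s. of_nat (((c - r) choose (s - m)) * ((b + c - 2 * r - s + m) choose m)) * (z ^ m * x ^ (s - m)))"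
proof -
  have "(\<Sum>j\<le>s. of_nat (((b - r) choose j) * ((c - r) choose (s - j))) * (z ^ j * (x + z) ^ (s - j))) =
      (\<Sum>i\<le>s. of_nat (((c - r) choose i) * ((b - r) choose (s - i))) * ((z + x) ^ i * z ^ (s - i)))"
    by (rule sum.reindex_bij_witness[of _ "\<lambda>i. s - i" "\<lambda>j. s - j"]) (auto simp: mult_ac add.commute)
  also have "\<dots> = (\<Sum>l\<le>s. of_nat (((c - r) choose l) * ((c - r + (b - r) - l) choose (s - l))) *
      (x ^ l * z ^ (s - l)))"
    by (rule binomial_pair_expansion)
  also have "\<dots> = (\<Sum>m\<le>s. of_nat (((c - r) choose (s - m)) * ((b + c - 2 * r - s + m) choose m)) *
      (z ^ m * x ^ (s - m)))"
  proof (rule sum.reindex_bij_witness[of _ "\<lambda>i. s - i" "\<lambda>j. s - j"], goal_cases)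
    case (5 l)
    then have "b + c - 2 * r - s + (s - l) = c - r + (b - r) - l"
      using assms by auto
    with 5 show ?case by (simp add: mult.commute)
  qed auto
  finally show ?thesis .
qed

lemma left_expansion:
  fixes x z :: "'a::comm_semiring_1"
  assumes "k \<le> a" "k \<le> b" "k \<le> n"
  shows "(\<Sum>j\<le>n - k. of_nat (((a - k) choose j) * ((b - k) choose (n - k - j))) *
      (z ^ k * (x + z) ^ j * x ^ (n - k - j))) =
    (\<Sum>l\<in>{k..n}. of_nat (((a - k) choose (l - k)) * ((a + b - k - l) choose (n - l))) * (z ^ l * x ^ (n - l)))"
proof -
  have "(\<Sum>j\<le>n - k. of_nat (((a - k) choose j) * ((b - k) choose (n - k - j))) *
      (z ^ k * (x + z) ^ j * x ^ (n - k - j))) =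
      z ^ k * (\<Sum>j\<le>n - k. of_nat (((a - k) choose j) * ((b - k) choose (n - k - j))) *
      ((x + z) ^ j * x ^ (n - k - j)))"
    by (simp add: sum_distrib_left mult_ac)
  also have "\<dots> = (\<Sum>l\<le>n - k. z ^ k * (of_nat (((a - k) choose l) *
      ((a - k + (b - k) - l) choose (n - k - l))) * (z ^ l * x ^ (n - k - l))))"
    unfolding binomial_pair_expansion sum_distrib_left ..
  also have "\<dots> = (\<Sum>l\<in>{k..n}. of_nat (((a - k) choose (l - k)) * ((a + b - k - l) choose (n - l))) *
      (z ^ l * x ^ (n - l)))"
  proof (rule sum.reindex_bij_witness[of _ "\<lambda>i. i - k" "\<lambda>j. j + k"], goal_cases)
    case (5 l)
    then have "a + b - k - (l + k) = a - k + (b - k) - l" "n - (l + k) = n - k - l"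
      using assms by auto
    then show ?case by (simp add: mult_ac power_add)
  qed (use assms in auto)
  finally show ?thesis .
qed

lemma coeff_sum_of_nat_powers:
  "finite A \<Longrightarrow> coeff (\<Sum>m\<in>A. of_nat (f m) * ([:0, 1:] ^ m * 1 ^ g m)) i =
    (if i \<in> A then of_nat (f i) else (0 :: complex))"
  by (simp add: coeff_sum of_nat_poly monom_altdef[of 1, simplified, symmetric] smult_monom
      if_distrib if_distribR sum.delta cong: if_cong)

text \<open>
  The polynomials for the right and left nested transvectants at \<open>x = 1\<close>, as polynomials in z.  Their
  defining expansions in powers of z and \<open>1 + z\<close> show a degree bound and a zero at -1 that cannot be
  read off from their coefficients.
\<close>

definition right_poly :: "nat \<Rightarrow> nat \<Rightarrow> nat \<Rightarrow> nat \<Rightarrow> complex poly" where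
  "right_poly b c r s = smult (1 / of_nat ((b + c - 2 * r) choose s))
    (\<Sum>j\<le>s. of_nat (((b - r) choose j) * ((c - r) choose (s - j))) *
      ([:0, 1:] ^ j * (1 + [:0, 1:]) ^ (s - j)))"

definition left_poly :: "nat \<Rightarrow> nat \<Rightarrow> nat \<Rightarrow> nat \<Rightarrow> complex poly" where
  "left_poly a b n k = smult (1 / of_nat ((a + b - 2 * k) choose (n - k)))
    (\<Sum>j\<le>n - k. of_nat (((a - k) choose j) * ((b - k) choose (n - k - j))) *
      ([:0, 1:] ^ k * (1 + [:0, 1:]) ^ j * 1 ^ (n - k - j)))"

lemma coeff_right_poly:
  assumes "r \<le> b" "r \<le> c" "s \<le> b + c - 2 * r"
  shows "coeff (right_poly b c r s) i = right_coeff b c r s i"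
  unfolding right_poly_def right_expansion[OF assms] coeff_smult
    coeff_sum_of_nat_powers[OF finite_atMost] right_coeff_def by simp

lemma coeff_left_poly:
  assumes "k \<le> a" "k \<le> b" "k \<le> n" "i \<le> n"
  shows "coeff (left_poly a b n k) i = left_coeff a b n k i"
  unfolding left_poly_def left_expansion[OF assms(1-3)] coeff_smult
    coeff_sum_of_nat_powers[OF finite_atLeastAtMost] left_coeff_def using assms by simp

lemma degree_powers_le: "degree (of_nat m * ([:0, 1:] ^ i * (1 + [:0, 1:]) ^ j :: complex poly)) \<le> i + j"
proof -
  have "degree ([:0, 1:] ^ i :: complex poly) \<le> i" "degree ((1 + [:0, 1:]) ^ j :: complex poly) \<le> j"
    using degree_power_le[of "[:0, 1:] :: complex poly" i]
      degree_power_le[of "1 + [:0, 1:] :: complex poly" j] by (auto simp: one_pCons)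
  then have "degree ([:0, 1:] ^ i * (1 + [:0, 1:]) ^ j :: complex poly) \<le> i + j"
    by (meson add_mono degree_mult_le order_trans)
  then show ?thesis
    by (simp add: of_nat_poly)
qed

text \<open>
  A term with \<open>j > b - r\<close> has the coefficient 0; in all others the exponent of \<open>1 + z\<close> is at least
  \<open>r + s - b\<close>.  The next lemma rests on the same observation.
\<close>

lemma right_poly_props:
  assumes "s \<le> a" "r \<le> b"
  shows "degree (right_poly b c r s) \<le> min a (r + s)"
    and "(1 + [:0, 1:]) ^ (r + s - b) dvd right_poly b c r s"
proof -
  show "degree (right_poly b c r s) \<le> min a (r + s)"
    unfolding right_poly_def using assms
    by (intro order_trans[OF degree_smult_le] degree_sum_le order_trans[OF degree_powers_le]) auto
  show "(1 + [:0, 1:]) ^ (r + s - b) dvd right_poly b c r s"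
    unfolding right_poly_def
  proof (intro dvd_smult dvd_sum)
    fix j
    show "(1 + [:0, 1:]) ^ (r + s - b) dvd of_nat (((b - r) choose j) * ((c - r) choose (s - j))) *
      ([:0, 1:] ^ j * (1 + [:0, 1:]) ^ (s - j) :: complex poly)"
    proof (cases "j \<le> b - r")
      case True
      then have "r + s - b \<le> s - j" using assms by auto
      then show ?thesis by (intro dvd_mult le_imp_power_dvd)
    qed (simp add: binomial_eq_0)
  qed
qed

lemma left_poly_props:
  assumes "k \<le> a" "k \<le> b" "k \<le> n"
  shows "degree (left_poly a b n k) \<le> min a n"
    and "(1 + [:0, 1:]) ^ (n - b) dvd left_poly a b n k"
proof -
  show "degree (left_poly a b n k) \<le> min a n"
    unfolding left_poly_def power_one mult_1_right
  proof (intro order_trans[OF degree_smult_le] degree_sum_le)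
    fix j assume j: "j \<in> {..n - k}"
    show "degree (of_nat (((a - k) choose j) * ((b - k) choose (n - k - j))) *
      ([:0, 1:] ^ k * (1 + [:0, 1:]) ^ j :: complex poly)) \<le> min a n"
    proof (cases "j \<le> a - k")
      case True
      then show ?thesis using j assms by (intro order_trans[OF degree_powers_le]) auto
    qed (simp add: binomial_eq_0)
  qed simp
  show "(1 + [:0, 1:]) ^ (n - b) dvd left_poly a b n k"
    unfolding left_poly_def power_one mult_1_right
  proof (intro dvd_smult dvd_sum)
    fix j
    show "(1 + [:0, 1:]) ^ (n - b) dvd of_nat (((a - k) choose j) * ((b - k) choose (n - k - j))) *
      ([:0, 1:] ^ k * (1 + [:0, 1:]) ^ j :: complex poly)"
    proof (cases "n - k - j \<le> b - k")
      case True
      then have "n - b \<le> j" using assms by auto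
      then show ?thesis by (intro dvd_mult le_imp_power_dvd)
    qed (simp add: binomial_eq_0)
  qed
qed

text \<open>
  For \<open>l \<le> K\<close> this is the triangular system.  If \<open>r + s\<close> exceeds a or b, then K is smaller than \<open>r + s\<close>, and
  the coefficients beyond K are equal for another reason.  The difference of the two polynomials has
  a zero of order at least \<open>K + 1\<close> at 0 and of order at least \<open>r + s - b\<close> at -1, but its degree is at most
  \<open>min a (r + s)\<close>.  In each of the cases for the minimum K this is too small for a nonzero polynomial.
\<close>

lemma coefficient_identity:
  assumes rs: "r \<le> b" "r \<le> c" "s \<le> a" "s \<le> b + c - 2 * r" and l: "l \<le> r + s"
    and K: "K = min (min a b) (min (a + b - r - s) (r + s))"
  shows "right_coeff b c r s l =
    (\<Sum>k\<le>K. theta (int a) (int b) (int c) (int r) (int s) (int k) * left_coeff a b (r + s) k l)"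
proof -
  let ?\<theta> = "\<lambda>k. theta (int a) (int b) (int c) (int r) (int s) (int k)"
  define D where "D = right_poly b c r s - (\<Sum>k\<le>K. smult (?\<theta> k) (left_poly a b (r + s) k))"
  have coeff_D: "coeff D i = right_coeff b c r s i - (\<Sum>k\<le>K. ?\<theta> k * left_coeff a b (r + s) k i)"
    if "i \<le> r + s" for i
    unfolding D_def using rs K that
    by (simp add: coeff_sum coeff_right_poly coeff_left_poly)
  \<comment> \<open>Zeros at 0 from the low coefficients, at -1 from the expansion in powers of \<open>1 + z\<close>.\<close>
  have "D = 0"
  proof (rule poly_eq_0_by_roots[of "K + 1" _ "r + s - b"])
    fix i assume "i < K + 1"
    then have i: "i \<le> K" by simp
    then have ir: "i \<le> a" "i \<le> b" "r + s + i \<le> a + b" "i \<le> r + s" using rs K by auto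
    have "(\<Sum>k\<le>K. ?\<theta> k * left_coeff a b (r + s) k i) = (\<Sum>k\<le>i. ?\<theta> k * left_coeff a b (r + s) k i)"
      using i by (intro sum.mono_neutral_right) (auto simp: left_coeff_def)
    then show "coeff D i = 0"
      using coeff_D[OF ir(4)] coefficient_identity_low[OF rs ir] by simp
  next
    have "(1 + [:0, 1:]) ^ (r + s - b) dvd D"
      unfolding D_def using K rs
      by (intro dvd_diff right_poly_props dvd_sum dvd_smult left_poly_props) auto
    then show "[:1, 1:] ^ (r + s - b) dvd D"
      by (simp add: one_pCons)
  next
    have "degree D \<le> min a (r + s)"
      unfolding D_def using K rs
      by (intro degree_diff_le right_poly_props degree_sum_le order_trans[OF degree_smult_le] left_poly_props) auto
    then show "degree D < K + 1 + (r + s - b)"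
      using K rs by (auto simp: min_def split: if_splits)
  qed
  then show ?thesis using coeff_D[OF l] by simp
qed

section \<open>Linear operators and derivations on polynomials in two variables\<close>

lemma scale_simps:
  "scale u (A + B) = scale u A + scale u B"
  "scale u (A - B) = scale u A - scale u B"
  "scale u (scale v A) = scale (u * v) A"
  "scale u A * B = scale u (A * B)"
  "A * scale u B = scale u (A * B)"
  "scale u 0 = 0" "scale 0 A = 0" "scale 1 A = A"
  "scale (- u) A = - scale u A" "scale u (- A) = - scale u A"
proof -
  have "[:- u:] = - [:u:]" by simp
  then show "scale (- u) A = - scale u A" by (simp only: scale_def smult_minus_left)
qed (simp_all add: scale_def smult_add_right smult_diff_right one_pCons[symmetric] mult.commute[of v u])

lemma scale_add_left: "scale (u + v) A = scale u A + scale v A"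
  by (simp add: scale_def flip: smult_add_left)

lemma scale_sum: "scale u (\<Sum>i\<in>I. f i) = (\<Sum>i\<in>I. scale u (f i))"
  by (induction I rule: infinite_finite_induct) (simp_all add: scale_simps)

lemma scale_of_nat: "scale (of_nat n) A = of_nat n * A"
  by (induction n) (simp_all add: scale_simps scale_add_left algebra_simps)

lemma scale_power: "scale u A ^ n = scale (u ^ n) (A ^ n)"
  by (induction n) (simp_all add: scale_simps mult_ac)

definition linear_op :: "(bipoly \<Rightarrow> bipoly) \<Rightarrow> bool" where
  "linear_op f \<longleftrightarrow> (\<forall>A B. f (A + B) = f A + f B) \<and> (\<forall>u A. f (scale u A) = scale u (f A))"

lemma linear_op_sum:
  assumes "linear_op f"
  shows "f (\<Sum>i\<in>I. g i) = (\<Sum>i\<in>I. f (g i))"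
proof -
  have "f 0 = 0" using assms scale_simps(7) unfolding linear_op_def by metis
  then show ?thesis
    using assms by (induction I rule: infinite_finite_induct) (simp_all add: linear_op_def)
qed

lemma linear_op_scale: "linear_op f \<Longrightarrow> f (scale u A) = scale u (f A)"
  by (simp add: linear_op_def)

lemma linear_op_minus: "linear_op f \<Longrightarrow> linear_op g \<Longrightarrow> linear_op (\<lambda>A. f A - g A)"
  by (simp add: linear_op_def scale_simps)

lemma linear_op_sum_fun: "(\<And>i. i \<in> I \<Longrightarrow> linear_op (f i)) \<Longrightarrow> linear_op (\<lambda>A. \<Sum>i\<in>I. f i A)"
  by (simp add: linear_op_def sum.distrib scale_sum)

lemma linear_op_scale_fun: "linear_op f \<Longrightarrow> linear_op (\<lambda>A. scale u (f A))"
  by (simp add: linear_op_def scale_simps mult.commute)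

lemma linear_op_compose: "linear_op f \<Longrightarrow> linear_op g \<Longrightarrow> linear_op (\<lambda>A. f (g A))"
  by (simp add: linear_op_def)

lemma linear_op_funpow: "linear_op f \<Longrightarrow> linear_op (f ^^ n)"
  by (induction n) (simp_all add: linear_op_def)

lemma linear_op_mult_left: "linear_op f \<Longrightarrow> linear_op (\<lambda>A. f A * B)"
  by (simp add: linear_op_def scale_simps algebra_simps)

lemma linear_op_mult_right: "linear_op f \<Longrightarrow> linear_op (\<lambda>A. B * f A)"
  by (simp add: linear_op_def scale_simps algebra_simps)

definition derivation :: "(bipoly \<Rightarrow> bipoly) \<Rightarrow> bool" where
  "derivation f \<longleftrightarrow> linear_op f \<and> (\<forall>A B. f (A * B) = f A * B + A * f B)"

lemma coeff_dx1: "coeff (dx1 A) j = pderiv (coeff A j)"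
  by (simp add: dx1_def coeff_map_poly)

lemma pderiv_sum_poly: "pderiv (\<Sum>i\<in>I. f i) = (\<Sum>i\<in>I. pderiv (f i))"
  by (induction I rule: infinite_finite_induct) (simp_all add: pderiv_add)

lemma derivation_dx1: "derivation dx1"
  unfolding derivation_def linear_op_def
proof (intro conjI allI; rule poly_eqI)
  fix A B u n
  show "coeff (dx1 (A + B)) n = coeff (dx1 A + dx1 B) n"
    by (simp add: coeff_dx1 pderiv_add)
  show "coeff (dx1 (scale u A)) n = coeff (scale u (dx1 A)) n"
    by (simp add: coeff_dx1 scale_def pderiv_smult)
  show "coeff (dx1 (A * B)) n = coeff (dx1 A * B + A * dx1 B) n"
    unfolding coeff_add coeff_mult coeff_dx1 pderiv_sum_poly sum.distrib[symmetric] pderiv_mult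
    by (rule sum.cong) (simp_all add: algebra_simps)
qed

lemma derivation_dx2: "derivation dx2"
  unfolding derivation_def linear_op_def dx2_def scale_def
  by (simp add: pderiv_add pderiv_smult pderiv_mult algebra_simps)

lemma dx1_dx2_commute: "dx1 (dx2 A) = dx2 (dx1 A)"
  by (rule poly_eqI)
    (simp add: coeff_dx1 dx2_def coeff_pderiv of_nat_poly pderiv_smult del: of_nat_Suc)

lemma linear_op_dx1: "linear_op dx1" and linear_op_dx2: "linear_op dx2"
  using derivation_dx1 derivation_dx2 by (simp_all add: derivation_def)

lemma dx1_funpow_dx2: "(dx1 ^^ i) (dx2 A) = dx2 ((dx1 ^^ i) A)"
  by (induction i) (simp_all add: dx1_dx2_commute)

lemma funpow_dx1_dx2_commute: "(dx1 ^^ i) ((dx2 ^^ j) A) = (dx2 ^^ j) ((dx1 ^^ i) A)"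
  by (induction j) (simp_all add: dx1_funpow_dx2)

lemma derivation_power:
  assumes "derivation f" and "f A = scale u 1"
  shows "f (A ^ p) = scale (of_nat p * u) (A ^ (p - 1))"
proof (induction p)
  case 0
  have "f (1 * 1) = f 1 + f 1" using assms(1) unfolding derivation_def by (metis mult.left_neutral mult.right_neutral)
  then show ?case by (simp add: scale_simps)
next
  case (Suc p)
  have "f (A ^ Suc p) = scale u 1 * A ^ p + A * scale (of_nat p * u) (A ^ (p - 1))"
    using assms Suc by (simp add: derivation_def)
  also have "\<dots> = scale (u + of_nat p * u) (A ^ p)"
    by (cases p) (simp_all add: scale_simps scale_add_left)
  finally show ?case by (simp add: algebra_simps)
qed

lemma derivation_funpow_power:
  assumes "derivation f" and "f A = scale u 1"
  shows "(f ^^ j) (A ^ p) = scale (of_nat (p choose j) * fact j * u ^ j) (A ^ (p - j))"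
proof (induction j)
  case 0
  show ?case by (simp add: scale_simps)
next
  case (Suc j)
  have "of_nat (p choose j) * of_nat (p - j) = (of_nat (p choose Suc j) * of_nat (Suc j) :: complex)"
    unfolding of_nat_mult[symmetric] by (simp only: binomial_absorb_comp[of p j, symmetric] binomial_absorption
        mult.commute Suc_times_binomial_eq)
  moreover have "(f ^^ Suc j) (A ^ p) =
      scale (of_nat (p choose j) * fact j * u ^ j * (of_nat (p - j) * u)) (A ^ (p - Suc j))"
    using assms Suc by (simp add: derivation_power derivation_def linear_op_scale scale_simps)
  ultimately show ?case by (simp add: mult_ac del: of_nat_Suc)
qed

lemma derivation_funpow_mult:
  assumes "derivation f"
  shows "(f ^^ m) (A * B) = (\<Sum>j\<le>m. of_nat (m choose j) * ((f ^^ j) A * (f ^^ (m - j)) B))"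
proof (induction m)
  case (Suc m)
  have lin: "linear_op f" and prod: "f (X * Y) = f X * Y + X * f Y" for X Y
    using assms by (simp_all add: derivation_def)
  have nat: "f (of_nat n * X) = of_nat n * f X" for n X
    by (simp add: linear_op_scale[OF lin] flip: scale_of_nat)
  have "(f ^^ Suc m) (A * B) = (\<Sum>j\<le>m. of_nat (m choose j) *
      ((f ^^ j) A * (f ^^ (Suc m - j)) B + (f ^^ Suc j) A * (f ^^ (Suc m - Suc j)) B))"
    unfolding funpow.simps o_apply Suc linear_op_sum[OF lin] nat
    by (intro sum.cong) (simp_all add: Suc_diff_le add.commute prod)
  then show ?case by (simp only: sum_choose_Suc)
qed simp

text \<open>
  This derivation kills \<open>x1 + u x2\<close>.  Up to a factor, its m-th power is what the m-th transvectant with a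
  power of \<open>x1 + u x2\<close> does to the other form.
\<close>

definition lform_annihilator :: "complex \<Rightarrow> bipoly \<Rightarrow> bipoly" where
  "lform_annihilator u A = scale u (dx1 A) - dx2 A"

lemma derivation_lform_annihilator: "derivation (lform_annihilator u)"
  using derivation_dx1 derivation_dx2
  by (simp add: derivation_def linear_op_def lform_annihilator_def scale_simps algebra_simps)

text \<open>
  The binomial theorem for the commuting operators \<open>dx1\<close> and \<open>dx2\<close>.
\<close>

lemma funpow_lform_annihilator:
  "(lform_annihilator u ^^ m) A =
    (\<Sum>i\<le>m. of_nat (m choose i) * scale ((-1) ^ i * u ^ (m - i)) ((dx1 ^^ (m - i)) ((dx2 ^^ i) A)))"
proof (induction m)
  case (Suc m)
  let ?g = "\<lambda>i j. scale ((-1) ^ j * u ^ i) ((dx1 ^^ i) ((dx2 ^^ j) A))"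
  have lin: "linear_op (lform_annihilator u)" using derivation_lform_annihilator by (simp add: derivation_def)
  have step: "lform_annihilator u (?g i j) = ?g (Suc i) j + ?g i (Suc j)" for i j
    unfolding linear_op_scale[OF lin] by (simp add: lform_annihilator_def scale_simps dx1_funpow_dx2 mult_ac)
  have nat: "lform_annihilator u (of_nat n * X) = of_nat n * lform_annihilator u X" for n X
    by (simp add: linear_op_scale[OF lin] flip: scale_of_nat)
  have "(lform_annihilator u ^^ Suc m) A = (\<Sum>j\<le>m. of_nat (m choose j) * (?g (Suc m - j) j + ?g (Suc m - Suc j) (Suc j)))"
    unfolding funpow.simps o_apply Suc linear_op_sum[OF lin] nat step
    by (intro sum.cong) (simp_all add: Suc_diff_le)
  then show ?case by (simp only: sum_choose_Suc)
qed (simp add: scale_simps)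

section \<open>Transvectants of powers of linear forms\<close>

text \<open>
  The linear form \<open>x1 + t x2\<close>.
\<close>

definition lform :: "complex \<Rightarrow> bipoly" where
  "lform t = [:[:0, 1:], [:t:]:]"

lemma lform_nonzero: "lform t \<noteq> 0"
  by (simp add: lform_def)

lemma dx1_lform: "dx1 (lform t) = scale 1 1"
  by (rule poly_eqI) (simp add: coeff_dx1 lform_def scale_simps coeff_pCons pderiv_pCons split: nat.split)

lemma dx2_lform: "dx2 (lform t) = scale t 1"
  by (simp add: dx2_def lform_def scale_def pderiv_pCons)

lemma lform_annihilator_lform: "lform_annihilator u (lform t) = scale (u - t) 1"
  by (simp add: lform_annihilator_def dx1_lform dx2_lform scale_simps scale_add_left[of u "-t", simplified])

text \<open>
  All derivatives of a power of a linear form are multiples of lower powers of it, so the sum in the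
  transvectant becomes the expansion of a power of \<open>lform_annihilator t\<close>.
\<close>

lemma transvectant_lform_power:
  assumes "m \<le> c"
  shows "transvectant N c m F (lform t ^ c) =
    scale (fact (N - m) / fact N) ((lform_annihilator t ^^ m) F * lform t ^ (c - m))"
proof -
  have der: "(dx2 ^^ (m - i)) ((dx1 ^^ i) (lform t ^ c)) =
      scale (fact c / fact (c - m) * t ^ (m - i)) (lform t ^ (c - m))" if "i \<le> m" for i
  proof -
    have "(dx2 ^^ (m - i)) ((dx1 ^^ i) (lform t ^ c)) =
        scale (of_nat (c choose i) * fact i * (of_nat ((c - i) choose (m - i)) * fact (m - i)) * t ^ (m - i))
          (lform t ^ (c - m))"
      using that by (simp add: derivation_funpow_power[OF derivation_dx1 dx1_lform]
          derivation_funpow_power[OF derivation_dx2 dx2_lform] scale_simps mult_ac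
          linear_op_scale[OF linear_op_funpow[OF linear_op_dx2]])
    also have "of_nat (c choose i) * fact i * (of_nat ((c - i) choose (m - i)) * fact (m - i)) =
        (fact c / fact (c - m) :: complex)"
      using that assms by (simp add: binomial_fact)
    finally show ?thesis .
  qed
  have "transvectant N c m F (lform t ^ c) =
      scale (fact (N - m) * fact (c - m) / (fact N * fact c))
       (\<Sum>i\<le>m. scale (fact c / fact (c - m)) (of_nat (m choose i) *
         scale ((-1) ^ i * t ^ (m - i)) ((dx1 ^^ (m - i)) ((dx2 ^^ i) F)) * lform t ^ (c - m)))"
    unfolding transvectant_def atMost_atLeast0
    by (intro arg_cong[where f = "scale _"] sum.cong)
      (simp_all add: der scale_simps mult_ac flip: scale_of_nat)
  also have "\<dots> = scale (fact (N - m) / fact N) ((lform_annihilator t ^^ m) F * lform t ^ (c - m))"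
    unfolding funpow_lform_annihilator scale_sum[symmetric] sum_distrib_right[symmetric]
    by (simp add: scale_simps)
  finally show ?thesis .
qed

text \<open>
  The Leibniz rule for the m-th power of \<open>lform_annihilator v\<close>, which maps the linear forms of parameters t
  and u to the constants \<open>v - t\<close> and \<open>v - u\<close>.
\<close>

lemma transvectant_lform_product:
  assumes "m \<le> c" "m \<le> p + q"
  shows "transvectant (p + q) c m (lform t ^ p * lform u ^ q) (lform v ^ c) =
    scale (1 / of_nat ((p + q) choose m)) (\<Sum>j\<le>m. of_nat ((p choose j) * (q choose (m - j))) *
      scale ((v - t) ^ j * (v - u) ^ (m - j)) (lform t ^ (p - j) * lform u ^ (q - (m - j)) * lform v ^ (c - m)))"
proof -
  have "(lform_annihilator v ^^ m) (lform t ^ p * lform u ^ q) =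
      scale (fact m) (\<Sum>j\<le>m. of_nat ((p choose j) * (q choose (m - j))) *
      scale ((v - t) ^ j * (v - u) ^ (m - j)) (lform t ^ (p - j) * lform u ^ (q - (m - j))))"
    unfolding derivation_funpow_mult[OF derivation_lform_annihilator] scale_sum
      derivation_funpow_power[OF derivation_lform_annihilator lform_annihilator_lform]
  proof (rule sum.cong)
    fix j assume "j \<in> {..m}"
    then show "of_nat (m choose j) * (scale (of_nat (p choose j) * fact j * (v - t) ^ j) (lform t ^ (p - j)) *
        scale (of_nat (q choose (m - j)) * fact (m - j) * (v - u) ^ (m - j)) (lform u ^ (q - (m - j)))) =
      scale (fact m) (of_nat ((p choose j) * (q choose (m - j))) *
      scale ((v - t) ^ j * (v - u) ^ (m - j)) (lform t ^ (p - j) * lform u ^ (q - (m - j))))"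
      unfolding scale_of_nat[symmetric] by (simp add: scale_simps binomial_fact mult_ac)
  qed simp
  moreover have "fact (p + q - m) / fact (p + q) * fact m = (1 / of_nat ((p + q) choose m) :: complex)"
    using assms by (simp add: binomial_fact)
  ultimately show ?thesis
    unfolding transvectant_lform_power[OF assms(1)]
    by (simp only: scale_simps sum_distrib_right mult.assoc)
qed

lemma transvectant_swap:
  assumes "r \<le> m" "r \<le> n"
  shows "transvectant m n r A B = scale ((-1) ^ r) (transvectant n m r B A)"
proof -
  have "(\<Sum>i=0..r. scale ((-1) ^ i * of_nat (r choose i))
          ((dx1 ^^ (r - i)) ((dx2 ^^ i) A) * (dx2 ^^ (r - i)) ((dx1 ^^ i) B))) =
      (\<Sum>i=0..r. scale ((-1) ^ r) (scale ((-1) ^ i * of_nat (r choose i))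
          ((dx1 ^^ (r - i)) ((dx2 ^^ i) B) * (dx2 ^^ (r - i)) ((dx1 ^^ i) A))))"
  proof (rule sum.reindex_bij_witness[of _ "\<lambda>i. r - i" "\<lambda>i. r - i"], goal_cases)
    case (5 i)
    then have i: "i \<le> r" by simp
    have "(-1) ^ r * (-1) ^ (r - i) = ((-1) ^ i :: complex)"
      using le_Suc_ex[OF i] by (auto simp: power_add mult.assoc simp flip: power_mult_distrib)
    then show ?case
      using i by (simp add: scale_simps funpow_dx1_dx2_commute binomial_symmetric[of i r, symmetric] mult_ac)
  qed auto
  then have "(\<Sum>i=0..r. scale ((-1) ^ i * of_nat (r choose i))
          ((dx1 ^^ (r - i)) ((dx2 ^^ i) A) * (dx2 ^^ (r - i)) ((dx1 ^^ i) B))) =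
      scale ((-1) ^ r) (\<Sum>i=0..r. scale ((-1) ^ i * of_nat (r choose i))
          ((dx1 ^^ (r - i)) ((dx2 ^^ i) B) * (dx2 ^^ (r - i)) ((dx1 ^^ i) A)))"
    by (simp only: scale_sum)
  then show ?thesis
    unfolding transvectant_def by (simp add: scale_simps mult_ac)
qed

lemma transvectant_lform_powers:
  assumes "r \<le> b" "r \<le> c"
  shows "transvectant b c r (lform u ^ b) (lform v ^ c) =
    scale ((v - u) ^ r) (lform u ^ (b - r) * lform v ^ (c - r))"
  using assms
  by (simp add: transvectant_lform_power derivation_funpow_power[OF derivation_lform_annihilator lform_annihilator_lform]
      scale_simps binomial_fact)

lemma linear_op_transvectant_left: "linear_op (\<lambda>A. transvectant m n r A B)"
  unfolding transvectant_def
  by (intro linear_op_scale_fun linear_op_sum_fun linear_op_mult_left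
      linear_op_compose[OF linear_op_funpow[OF linear_op_dx1] linear_op_funpow[OF linear_op_dx2]])

lemma linear_op_transvectant_right: "linear_op (\<lambda>B. transvectant m n r A B)"
  unfolding transvectant_def
  by (intro linear_op_scale_fun linear_op_sum_fun linear_op_mult_right
      linear_op_compose[OF linear_op_funpow[OF linear_op_dx2] linear_op_funpow[OF linear_op_dx1]])

section \<open>Iterated transvectants of powers of linear forms\<close>

text \<open>
  The Pluecker relation between three linear forms.  It allows the three products of brackets and linear
  forms to be written as x, z and \<open>x + z\<close>.
\<close>

lemma lform_bracket_relation:
  "scale (v - u) (lform t) + scale (u - t) (lform v) = scale (v - t) (lform u)"
  by (simp add: lform_def scale_def algebra_simps)

lemma right_expansion_scale:
  assumes "r \<le> b" "r \<le> c" "s \<le> b + c - 2 * r"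
  shows "scale (1 / of_nat ((b + c - 2 * r) choose s))
      (\<Sum>j\<le>s. of_nat (((b - r) choose j) * ((c - r) choose (s - j))) *
        (x ^ r * z ^ j * (x + z) ^ (s - j))) =
    (\<Sum>l\<le>r + s. scale (right_coeff b c r s l) (z ^ l * x ^ (r + s - l)))"
proof -
  have "(\<Sum>j\<le>s. of_nat (((b - r) choose j) * ((c - r) choose (s - j))) *
        (x ^ r * z ^ j * (x + z) ^ (s - j))) =
      x ^ r * (\<Sum>j\<le>s. of_nat (((b - r) choose j) * ((c - r) choose (s - j))) *
        (z ^ j * (x + z) ^ (s - j)))"
    by (simp add: sum_distrib_left mult_ac)
  also have "\<dots> = (\<Sum>m\<le>s. of_nat (((c - r) choose (s - m)) * ((b + c - 2 * r - s + m) choose m)) *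
      (z ^ m * x ^ (r + s - m)))"
    unfolding right_expansion[OF assms] sum_distrib_left
    by (rule sum.cong) (simp_all add: power_add mult_ac flip: Nat.add_diff_assoc)
  finally have "scale (1 / of_nat ((b + c - 2 * r) choose s))
      (\<Sum>j\<le>s. of_nat (((b - r) choose j) * ((c - r) choose (s - j))) *
        (x ^ r * z ^ j * (x + z) ^ (s - j))) =
      (\<Sum>m\<le>s. scale (right_coeff b c r s m) (z ^ m * x ^ (r + s - m)))"
    by (simp only: scale_sum) (rule sum.cong, simp_all add: right_coeff_def scale_simps flip: scale_of_nat)
  also have "\<dots> = (\<Sum>l\<le>r + s. scale (right_coeff b c r s l) (z ^ l * x ^ (r + s - l)))"
    by (rule sum.mono_neutral_left) (auto simp: right_coeff_def scale_simps)
  finally show ?thesis .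
qed

lemma left_expansion_scale:
  assumes "k \<le> a" "k \<le> b" "k \<le> n"
  shows "scale (1 / of_nat ((a + b - 2 * k) choose (n - k)))
      (\<Sum>j\<le>n - k. of_nat (((a - k) choose j) * ((b - k) choose (n - k - j))) *
        (z ^ k * (x + z) ^ j * x ^ (n - k - j))) =
    (\<Sum>l\<le>n. scale (left_coeff a b n k l) (z ^ l * x ^ (n - l)))"
proof -
  have "scale (1 / of_nat ((a + b - 2 * k) choose (n - k)))
      (\<Sum>j\<le>n - k. of_nat (((a - k) choose j) * ((b - k) choose (n - k - j))) *
        (z ^ k * (x + z) ^ j * x ^ (n - k - j))) =
      (\<Sum>l\<in>{k..n}. scale (left_coeff a b n k l) (z ^ l * x ^ (n - l)))"
    unfolding left_expansion[OF assms] scale_sum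
    by (rule sum.cong) (simp_all add: left_coeff_def scale_simps flip: scale_of_nat)
  also have "\<dots> = (\<Sum>l\<le>n. scale (left_coeff a b n k l) (z ^ l * x ^ (n - l)))"
    by (rule sum.mono_neutral_left) (auto simp: left_coeff_def scale_simps)
  finally show ?thesis .
qed

text \<open>
  With \<open>coefficient_identity\<close> in place for each monomial in x and z, the expansion holds in the form in which
  the transvectants will present it.
\<close>

lemma right_left_identity:
  assumes rs: "r \<le> b" "r \<le> c" "s \<le> a" "s \<le> b + c - 2 * r"
    and K: "K = min (min a b) (min (a + b - r - s) (r + s))"
  shows "scale (1 / of_nat ((b + c - 2 * r) choose s))
      (\<Sum>j\<le>s. of_nat (((b - r) choose j) * ((c - r) choose (s - j))) *
        (x ^ r * z ^ j * (x + z) ^ (s - j))) =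
    (\<Sum>k\<le>K. scale (theta (int a) (int b) (int c) (int r) (int s) (int k))
      (scale (1 / of_nat ((a + b - 2 * k) choose (r + s - k)))
        (\<Sum>j\<le>r + s - k. of_nat (((a - k) choose j) * ((b - k) choose (r + s - k - j))) *
          (z ^ k * (x + z) ^ j * x ^ (r + s - k - j)))))"
proof -
  let ?\<theta> = "\<lambda>k. theta (int a) (int b) (int c) (int r) (int s) (int k)"
  have "(\<Sum>l\<le>r + s. scale (right_coeff b c r s l) (z ^ l * x ^ (r + s - l))) =
      (\<Sum>l\<le>r + s. \<Sum>k\<le>K. scale (?\<theta> k) (scale (left_coeff a b (r + s) k l) (z ^ l * x ^ (r + s - l))))"
  proof (rule sum.cong)
    fix l assume "l \<in> {..r + s}"
    then have "right_coeff b c r s l = (\<Sum>k\<le>K. ?\<theta> k * left_coeff a b (r + s) k l)"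
      using rs K by (intro coefficient_identity) auto
    moreover have "scale (\<Sum>k\<le>K. f k) X = (\<Sum>k\<le>K. scale (f k) X)" for f X
      by (induction K) (simp_all add: scale_add_left)
    ultimately show "scale (right_coeff b c r s l) (z ^ l * x ^ (r + s - l)) =
        (\<Sum>k\<le>K. scale (?\<theta> k) (scale (left_coeff a b (r + s) k l) (z ^ l * x ^ (r + s - l))))"
      by (simp add: scale_simps)
  qed simp
  also have "\<dots> = (\<Sum>k\<le>K. scale (?\<theta> k)
      (\<Sum>l\<le>r + s. scale (left_coeff a b (r + s) k l) (z ^ l * x ^ (r + s - l))))"
    by (subst sum.swap) (simp add: scale_sum)
  also have "\<dots> = (\<Sum>k\<le>K. scale (?\<theta> k) (scale (1 / of_nat ((a + b - 2 * k) choose (r + s - k)))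
        (\<Sum>j\<le>r + s - k. of_nat (((a - k) choose j) * ((b - k) choose (r + s - k - j))) *
          (z ^ k * (x + z) ^ j * x ^ (r + s - k - j)))))"
  proof (rule sum.cong)
    fix k assume "k \<in> {..K}"
    then have k: "k \<le> a" "k \<le> b" "k \<le> r + s" using K by auto
    show "scale (?\<theta> k) (\<Sum>l\<le>r + s. scale (left_coeff a b (r + s) k l) (z ^ l * x ^ (r + s - l))) =
        scale (?\<theta> k) (scale (1 / of_nat ((a + b - 2 * k) choose (r + s - k)))
        (\<Sum>j\<le>r + s - k. of_nat (((a - k) choose j) * ((b - k) choose (r + s - k - j))) *
          (z ^ k * (x + z) ^ j * x ^ (r + s - k - j))))"
      unfolding left_expansion_scale[OF k] ..
  qed simp
  finally show ?thesis
    unfolding right_expansion_scale[OF rs(1,2,4)] .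
qed

text \<open>
  Every term of the right nested transvectant is a product of brackets \<open>v - u\<close>, \<open>u - t\<close>, \<open>v - t\<close> and linear
  forms.  Multiplication by the power of the three linear forms supplies each bracket with its
  two linear forms, without negative exponents; terms that would need such exponents from the
  outset have the coefficient 0.
\<close>

lemma nested_right_cleared:
  fixes t u v :: complex
  assumes rs: "r \<le> b" "r \<le> c" "s \<le> a" "s \<le> b + c - 2 * r"
  defines "x \<equiv> scale (v - u) (lform t)" and "z \<equiv> scale (u - t) (lform v)"
  shows "(lform t * lform u * lform v) ^ (r + s) *
      transvectant a (b + c - 2 * r) s (lform t ^ a) (transvectant b c r (lform u ^ b) (lform v ^ c)) =
    lform t ^ a * lform u ^ b * lform v ^ c *
      scale (1 / of_nat ((b + c - 2 * r) choose s))
      (\<Sum>j\<le>s. of_nat (((b - r) choose j) * ((c - r) choose (s - j))) *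
        (x ^ r * z ^ j * (x + z) ^ (s - j)))" (is "?F * ?T = _")
proof -
  have xz: "x + z = scale (v - t) (lform u)"
    unfolding x_def z_def by (rule lform_bracket_relation)
  have deg: "b - r + (c - r) = b + c - 2 * r" using rs by auto
  have "?T = scale ((-1) ^ s) (transvectant (b - r + (c - r)) a s
        (scale ((v - u) ^ r) (lform u ^ (b - r) * lform v ^ (c - r))) (lform t ^ a))"
    unfolding transvectant_lform_powers[OF rs(1,2)] deg
    by (rule transvectant_swap[OF rs(3,4)])
  also have "\<dots> = scale ((-1) ^ s) (scale ((v - u) ^ r) (scale (1 / of_nat ((b + c - 2 * r) choose s))
      (\<Sum>j\<le>s. of_nat (((b - r) choose j) * ((c - r) choose (s - j))) *
      scale ((t - u) ^ j * (t - v) ^ (s - j))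
        (lform u ^ (b - r - j) * lform v ^ (c - r - (s - j)) * lform t ^ (a - s)))))"
    using rs by (subst linear_op_scale[OF linear_op_transvectant_left], subst transvectant_lform_product)
      (simp_all add: deg)
  finally have T: "?T = \<dots>" .
  have "?F * ?T =
      scale (1 / of_nat ((b + c - 2 * r) choose s))
      (\<Sum>j\<le>s. (lform t * lform u * lform v) ^ (r + s) * scale ((-1) ^ s * (v - u) ^ r)
        (of_nat (((b - r) choose j) * ((c - r) choose (s - j))) *
      scale ((t - u) ^ j * (t - v) ^ (s - j))
        (lform u ^ (b - r - j) * lform v ^ (c - r - (s - j)) * lform t ^ (a - s))))"
    unfolding T by (simp only: scale_simps sum_distrib_left scale_sum mult_ac)
  also have "\<dots> = scale (1 / of_nat ((b + c - 2 * r) choose s))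
      (\<Sum>j\<le>s. lform t ^ a * lform u ^ b * lform v ^ c *
        (of_nat (((b - r) choose j) * ((c - r) choose (s - j))) *
        (x ^ r * z ^ j * (x + z) ^ (s - j))))"
  proof (rule arg_cong[where f = "scale _"], rule sum.cong)
    fix j assume j: "j \<in> {..s}"
    show "(lform t * lform u * lform v) ^ (r + s) * scale ((-1) ^ s * (v - u) ^ r)
        (of_nat (((b - r) choose j) * ((c - r) choose (s - j))) *
      scale ((t - u) ^ j * (t - v) ^ (s - j))
        (lform u ^ (b - r - j) * lform v ^ (c - r - (s - j)) * lform t ^ (a - s))) =
      lform t ^ a * lform u ^ b * lform v ^ c *
        (of_nat (((b - r) choose j) * ((c - r) choose (s - j))) *
        (x ^ r * z ^ j * (x + z) ^ (s - j)))"
    proof (cases "j \<le> b - r \<and> s - j \<le> c - r")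
      case True
      define N where "N = (of_nat (((b - r) choose j) * ((c - r) choose (s - j))) :: bipoly)"
      have e: "a + r = a - s + (r + s)" "b + (s - j) = b - r - j + (r + s)"
        "c + j = c - r - (s - j) + (r + s)"
        using True rs j by auto
      \<comment> \<open>The sign from exchanging the two arguments turns the brackets around.\<close>
      have sgn: "(-1) ^ s * ((t - u) ^ j * (t - v) ^ (s - j)) = (u - t) ^ j * (v - t) ^ (s - j)"
      proof -
        have "(-1) ^ s = ((-1) ^ j * (-1) ^ (s - j) :: complex)"
          using j by (simp flip: power_add)
        then have "(-1) ^ s * ((t - u) ^ j * (t - v) ^ (s - j)) =
            ((-1) ^ j * (t - u) ^ j) * ((-1) ^ (s - j) * (t - v) ^ (s - j))"
          by (simp only: mult_ac)
        then show ?thesis by (simp flip: power_mult_distrib)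
      qed
      have "(lform t * lform u * lform v) ^ (r + s) * scale ((-1) ^ s * (v - u) ^ r)
        (N * scale ((t - u) ^ j * (t - v) ^ (s - j))
        (lform u ^ (b - r - j) * lform v ^ (c - r - (s - j)) * lform t ^ (a - s))) =
        scale ((v - u) ^ r * ((-1) ^ s * ((t - u) ^ j * (t - v) ^ (s - j))))
          (N * (lform t ^ (a - s + (r + s)) * lform u ^ (b - r - j + (r + s)) *
          lform v ^ (c - r - (s - j) + (r + s))))"
        by (simp only: scale_simps power_mult_distrib power_add mult_ac)
      also have "\<dots> = lform t ^ a * lform u ^ b * lform v ^ c * (N *
        (x ^ r * z ^ j * (x + z) ^ (s - j)))"
        unfolding sgn e[symmetric] xz unfolding x_def z_def scale_power
        by (simp only: scale_simps power_mult_distrib power_add mult_ac)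
      finally show ?thesis unfolding N_def .
    qed (auto simp: binomial_eq_0 scale_simps)
  qed simp
  also have "\<dots> = lform t ^ a * lform u ^ b * lform v ^ c *
      scale (1 / of_nat ((b + c - 2 * r) choose s))
      (\<Sum>j\<le>s. of_nat (((b - r) choose j) * ((c - r) choose (s - j))) *
        (x ^ r * z ^ j * (x + z) ^ (s - j)))"
    by (simp only: scale_simps sum_distrib_left)
  finally show ?thesis .
qed

lemma nested_left_cleared:
  fixes t u v :: complex
  assumes k: "k \<le> a" "k \<le> b" "k \<le> n" "n \<le> c + k" "k + n \<le> a + b"
  defines "x \<equiv> scale (v - u) (lform t)" and "z \<equiv> scale (u - t) (lform v)"
  shows "(lform t * lform u * lform v) ^ n *
      transvectant (a + b - 2 * k) c (n - k) (transvectant a b k (lform t ^ a) (lform u ^ b)) (lform v ^ c) =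
    lform t ^ a * lform u ^ b * lform v ^ c *
      scale (1 / of_nat ((a + b - 2 * k) choose (n - k)))
      (\<Sum>j\<le>n - k. of_nat (((a - k) choose j) * ((b - k) choose (n - k - j))) *
        (z ^ k * (x + z) ^ j * x ^ (n - k - j)))" (is "?F * ?T = _")
proof -
  have xz: "x + z = scale (v - t) (lform u)"
    unfolding x_def z_def by (rule lform_bracket_relation)
  have deg: "a - k + (b - k) = a + b - 2 * k" using k by auto
  have T: "?T = scale ((u - t) ^ k) (scale (1 / of_nat ((a + b - 2 * k) choose (n - k)))
      (\<Sum>j\<le>n - k. of_nat (((a - k) choose j) * ((b - k) choose (n - k - j))) *
      scale ((v - t) ^ j * (v - u) ^ (n - k - j))
        (lform t ^ (a - k - j) * lform u ^ (b - k - (n - k - j)) * lform v ^ (c - (n - k)))))"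
    unfolding transvectant_lform_powers[OF k(1,2)] deg[symmetric]
    using k by (subst linear_op_scale[OF linear_op_transvectant_left], subst transvectant_lform_product) simp_all
  have "?F * ?T =
      scale (1 / of_nat ((a + b - 2 * k) choose (n - k)))
      (\<Sum>j\<le>n - k. (lform t * lform u * lform v) ^ n * scale ((u - t) ^ k)
        (of_nat (((a - k) choose j) * ((b - k) choose (n - k - j))) *
      scale ((v - t) ^ j * (v - u) ^ (n - k - j))
        (lform t ^ (a - k - j) * lform u ^ (b - k - (n - k - j)) * lform v ^ (c - (n - k)))))"
    unfolding T by (simp only: scale_simps sum_distrib_left scale_sum mult_ac)
  also have "\<dots> = scale (1 / of_nat ((a + b - 2 * k) choose (n - k)))
      (\<Sum>j\<le>n - k. lform t ^ a * lform u ^ b * lform v ^ c *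
        (of_nat (((a - k) choose j) * ((b - k) choose (n - k - j))) *
        (z ^ k * (x + z) ^ j * x ^ (n - k - j))))"
  proof (rule arg_cong[where f = "scale _"], rule sum.cong)
    fix j assume j: "j \<in> {..n - k}"
    show "(lform t * lform u * lform v) ^ n * scale ((u - t) ^ k)
        (of_nat (((a - k) choose j) * ((b - k) choose (n - k - j))) *
      scale ((v - t) ^ j * (v - u) ^ (n - k - j))
        (lform t ^ (a - k - j) * lform u ^ (b - k - (n - k - j)) * lform v ^ (c - (n - k)))) =
      lform t ^ a * lform u ^ b * lform v ^ c *
        (of_nat (((a - k) choose j) * ((b - k) choose (n - k - j))) *
        (z ^ k * (x + z) ^ j * x ^ (n - k - j)))"
    proof (cases "j \<le> a - k \<and> n - k - j \<le> b - k")
      case True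
      define N where "N = (of_nat (((a - k) choose j) * ((b - k) choose (n - k - j))) :: bipoly)"
      have e: "a + (n - k - j) = a - k - j + n" "b + j = b - k - (n - k - j) + n"
        "c + k = c - (n - k) + n"
        using True k j by auto
      have "(lform t * lform u * lform v) ^ n * scale ((u - t) ^ k)
        (N * scale ((v - t) ^ j * (v - u) ^ (n - k - j))
        (lform t ^ (a - k - j) * lform u ^ (b - k - (n - k - j)) * lform v ^ (c - (n - k)))) =
        scale ((u - t) ^ k * ((v - t) ^ j * (v - u) ^ (n - k - j)))
          (N * (lform t ^ (a - k - j + n) * lform u ^ (b - k - (n - k - j) + n) *
          lform v ^ (c - (n - k) + n)))"
        by (simp only: scale_simps power_mult_distrib power_add mult_ac)
      also have "\<dots> = lform t ^ a * lform u ^ b * lform v ^ c * (N *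
        (z ^ k * (x + z) ^ j * x ^ (n - k - j)))"
        unfolding e[symmetric] xz unfolding x_def z_def scale_power
        by (simp only: scale_simps power_mult_distrib power_add mult_ac)
      finally show ?thesis unfolding N_def .
    qed (auto simp: binomial_eq_0 scale_simps)
  qed simp
  also have "\<dots> = lform t ^ a * lform u ^ b * lform v ^ c *
      scale (1 / of_nat ((a + b - 2 * k) choose (n - k)))
      (\<Sum>j\<le>n - k. of_nat (((a - k) choose j) * ((b - k) choose (n - k - j))) *
        (z ^ k * (x + z) ^ j * x ^ (n - k - j)))"
    by (simp only: scale_simps sum_distrib_left)
  finally show ?thesis .
qed

text \<open>
  The lower bound \<open>r + s - c\<close> of the index set can be dropped for a summand that vanishes below it, and
  the upper bounds amount to \<open>k \<le> K\<close>.
\<close>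

lemma sum_K_range:
  fixes a b c r s :: nat
  assumes "r + s \<le> a + b" and K: "K = min (min a b) (min (a + b - r - s) (r + s))"
    and low: "\<And>k. k \<le> K \<Longrightarrow> c + k < r + s \<Longrightarrow> f k = 0"
  shows "(\<Sum>k\<in>K_range (int a) (int b) (int c) (int r) (int s). f (nat k)) = (\<Sum>k\<le>K. f k :: bipoly)"
proof -
  have "(\<Sum>k\<in>K_range (int a) (int b) (int c) (int r) (int s). f (nat k)) =
      (\<Sum>k\<in>{k. k \<le> K \<and> r + s \<le> c + k}. f k)"
    using assms(1) K
    by (intro sum.reindex_bij_witness[of _ int nat]) (auto simp: K_range_def)
  also have "\<dots> = (\<Sum>k\<le>K. f k)"
    by (rule sum.mono_neutral_left) (auto intro!: low)
  finally show ?thesis .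
qed

text \<open>
  After multiplication by a power of the three linear forms, both sides have the same explicit factor,
  and the remaining factors agree by \<open>right_left_identity\<close>.  The ring of polynomials is a domain, so the
  power can be cancelled.
\<close>

lemma transvectant_identity_lform_powers:
  fixes a b c r s :: nat
  assumes rs: "r \<le> b" "r \<le> c" "s \<le> a" "s \<le> b + c - 2 * r"
  shows "transvectant a (b + c - 2 * r) s (lform t ^ a) (transvectant b c r (lform u ^ b) (lform v ^ c)) =
    (\<Sum>k\<in>K_range (int a) (int b) (int c) (int r) (int s).
       scale (theta (int a) (int b) (int c) (int r) (int s) k)
         (transvectant (a + b - 2 * nat k) c (r + s - nat k)
           (transvectant a b (nat k) (lform t ^ a) (lform u ^ b)) (lform v ^ c)))"
    (is "?L = ?R")
proof -
  define K where "K = min (min a b) (min (a + b - r - s) (r + s))"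
  let ?\<theta> = "\<lambda>k. theta (int a) (int b) (int c) (int r) (int s) (int k)"
  let ?T = "\<lambda>k. transvectant (a + b - 2 * k) c (r + s - k) (transvectant a b k (lform t ^ a) (lform u ^ b)) (lform v ^ c)"
  let ?F = "(lform t * lform u * lform v) ^ (r + s)"
  let ?G = "lform t ^ a * lform u ^ b * lform v ^ c"
  define x where "x = scale (v - u) (lform t)"
  define z where "z = scale (u - t) (lform v)"
  let ?S = "\<lambda>k. scale (1 / of_nat ((a + b - 2 * k) choose (r + s - k)))
        (\<Sum>j\<le>r + s - k. of_nat (((a - k) choose j) * ((b - k) choose (r + s - k - j))) *
          (z ^ k * (x + z) ^ j * x ^ (r + s - k - j)))"
  have theta_0: "?\<theta> k = 0" if "c + k < r + s" for k
    using that by (auto simp: theta_def K_range_def)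
  have "?R = (\<Sum>k\<in>K_range (int a) (int b) (int c) (int r) (int s). scale (?\<theta> (nat k)) (?T (nat k)))"
    by (rule sum.cong) (auto simp: K_range_def)
  also have "\<dots> = (\<Sum>k\<le>K. scale (?\<theta> k) (?T k))"
    using rs by (intro sum_K_range[of r s a b K c "\<lambda>k. scale (?\<theta> k) (?T k)"]) (auto simp: K_def theta_0 scale_simps)
  finally have R: "?R = (\<Sum>k\<le>K. scale (?\<theta> k) (?T k))" .
  have "?F * ?R = (\<Sum>k\<le>K. scale (?\<theta> k) (?F * ?T k))"
    unfolding R by (simp only: sum_distrib_left scale_simps)
  also have "\<dots> = (\<Sum>k\<le>K. scale (?\<theta> k) (?G * ?S k))"
  proof (rule sum.cong)
    fix k assume "k \<in> {..K}"
    then have k: "k \<le> a" "k \<le> b" "k \<le> r + s" "k + (r + s) \<le> a + b" using rs by (auto simp: K_def)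
    show "scale (?\<theta> k) (?F * ?T k) = scale (?\<theta> k) (?G * ?S k)"
    proof (cases "r + s \<le> c + k")
      case True
      show ?thesis
        using nested_left_cleared[OF k(1-3) True k(4), of t u v] unfolding x_def z_def by simp
    qed (simp add: theta_0 scale_simps)
  qed simp
  also have "\<dots> = ?G * (\<Sum>k\<le>K. scale (?\<theta> k) (?S k))"
    by (simp only: sum_distrib_left scale_simps)
  also have "\<dots> = ?F * ?L"
    unfolding right_left_identity[OF rs K_def, symmetric] x_def z_def
    by (rule nested_right_cleared[OF rs, symmetric])
  finally have eq: "?F * ?R = ?F * ?L" .
  have "?F \<noteq> 0" by (simp add: lform_nonzero)
  then show ?thesis
    by (rule mult_left_cancel[THEN iffD1, OF _ eq[symmetric]])
qed

section \<open>From powers of linear forms to all forms\<close>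

definition mono_form :: "nat \<Rightarrow> nat \<Rightarrow> bipoly" where
  "mono_form m i = monom (monom 1 (m - i)) i"

lemma lform_power:
  "lform t ^ m = (\<Sum>i\<le>m. scale (of_nat (m choose i) * t ^ i) (mono_form m i))"
proof -
  have "lform t = monom (monom t 0) 1 + monom (monom 1 1) 0"
    by (simp add: lform_def monom_altdef)
  then have "lform t ^ m = (\<Sum>i\<le>m. of_nat (m choose i) * monom (monom t 0) 1 ^ i * monom (monom 1 1) 0 ^ (m - i))"
    by (simp only: binomial_ring)
  also have "\<dots> = (\<Sum>i\<le>m. scale (of_nat (m choose i) * t ^ i) (mono_form m i))"
  proof (rule sum.cong)
    fix i
    have "monom (monom t 0) 1 ^ i * monom (monom 1 1) 0 ^ (m - i) = scale (t ^ i) (mono_form m i)"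
      by (simp add: monom_power mult_monom mono_form_def scale_def smult_monom)
    then show "of_nat (m choose i) * monom (monom t 0) 1 ^ i * monom (monom 1 1) 0 ^ (m - i) =
        scale (of_nat (m choose i) * t ^ i) (mono_form m i)"
      by (simp add: mult.assoc scale_simps flip: scale_of_nat)
  qed simp
  finally show ?thesis .
qed

lemma binary_form_expansion:
  assumes "binary_form m A"
  shows "A = (\<Sum>i\<le>m. scale (coeff (coeff A i) (m - i)) (mono_form m i))"
proof (intro poly_eqI)
  fix j i
  have "coeff (coeff (\<Sum>i\<le>m. scale (coeff (coeff A i) (m - i)) (mono_form m i)) j) i =
      (\<Sum>l\<le>m. if l = j then (if m - j = i then coeff (coeff A j) (m - j) else 0) else 0)"
    unfolding coeff_sum by (rule sum.cong) (auto simp: mono_form_def scale_def coeff_sum smult_monom)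
  also have "\<dots> = coeff (coeff A j) i"
    using assms unfolding binary_form_def by (auto simp: le_iff_add) (metis add.commute add_diff_cancel_right' le_add2)+
  finally show "coeff (coeff A j) i =
    coeff (coeff (\<Sum>i\<le>m. scale (coeff (coeff A i) (m - i)) (mono_form m i)) j) i" ..
qed

text \<open>
  Expanded in powers of t, the hypothesis is a polynomial identity in t, so the value at each
  monomial of degree m vanishes.  In effect, the m-th powers of linear forms span the
  forms of order m.
\<close>

lemma linear_op_zero_on_forms:
  assumes lin: "linear_op f" and zero: "\<And>t. f (lform t ^ m) = 0" and A: "binary_form m A"
  shows "f A = 0"
proof -
  have mono: "f (mono_form m i) = 0" if "i \<le> m" for i
  proof (intro poly_eqI)
    fix j l
    define w where "w i = coeff (coeff (f (mono_form m i)) j) l" for i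
    define p where "p = (\<Sum>i\<le>m. monom (of_nat (m choose i) * w i) i)"
    have "poly p t = 0" for t
    proof -
      have "coeff (coeff (f (lform t ^ m)) j) l = (\<Sum>i\<le>m. of_nat (m choose i) * t ^ i * w i)"
        unfolding lform_power linear_op_sum[OF lin] linear_op_scale[OF lin]
        by (simp add: coeff_sum scale_def w_def)
      then show ?thesis
        unfolding zero by (simp add: p_def poly_sum poly_monom mult_ac)
    qed
    then have "p = 0" by (simp add: poly_all_0_iff_0[symmetric])
    moreover have "coeff p i = of_nat (m choose i) * w i"
      using that by (simp add: p_def coeff_sum)
    ultimately have "of_nat (m choose i) * w i = 0" by simp
    moreover have "of_nat (m choose i) \<noteq> (0 :: complex)" using that by (simp add: binomial_eq_0_iff)
    ultimately show "coeff (coeff (f (mono_form m i)) j) l = coeff (coeff 0 j) l"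
      by (simp add: w_def)
  qed
  have "f A = (\<Sum>i\<le>m. scale (coeff (coeff A i) (m - i)) (f (mono_form m i)))"
    by (subst binary_form_expansion[OF A]) (simp only: linear_op_sum[OF lin] linear_op_scale[OF lin])
  then show ?thesis using mono by (simp add: scale_simps)
qed

text \<open>
  The difference of the two sides is linear in each form separately, so each of the three
  forms may be replaced by powers of linear forms.
\<close>

theorem theorem7p2:
  fixes A B C :: bipoly and a b c r s :: nat
  assumes "binary_form a A" and "binary_form b B" and "binary_form c C"
    and "r \<le> min b c" and "s \<le> min a (b + c - 2 * r)"
  shows "transvectant a (b + c - 2 * r) s A (transvectant b c r B C) =
    (\<Sum>k\<in>K_range (int a) (int b) (int c) (int r) (int s).
       scale (theta (int a) (int b) (int c) (int r) (int s) k)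
         (transvectant (a + b - 2 * nat k) c (r + s - nat k) (transvectant a b (nat k) A B) C))"
proof -
  define D where "D A B C = transvectant a (b + c - 2 * r) s A (transvectant b c r B C) -
    (\<Sum>k\<in>K_range (int a) (int b) (int c) (int r) (int s).
       scale (theta (int a) (int b) (int c) (int r) (int s) k)
         (transvectant (a + b - 2 * nat k) c (r + s - nat k) (transvectant a b (nat k) A B) C))" for A B C
  have lin_A: "linear_op (\<lambda>A. D A B C)" for B C
    unfolding D_def
    by (intro linear_op_minus linear_op_sum_fun linear_op_scale_fun linear_op_transvectant_left
        linear_op_compose[OF linear_op_transvectant_left linear_op_transvectant_left])
  have lin_B: "linear_op (\<lambda>B. D A B C)" for A C
    unfolding D_def
    by (intro linear_op_minus linear_op_sum_fun linear_op_scale_fun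
        linear_op_compose[OF linear_op_transvectant_right linear_op_transvectant_left]
        linear_op_compose[OF linear_op_transvectant_left linear_op_transvectant_right])
  have lin_C: "linear_op (\<lambda>C. D A B C)" for A B
    unfolding D_def
    by (intro linear_op_minus linear_op_sum_fun linear_op_scale_fun linear_op_transvectant_right
        linear_op_compose[OF linear_op_transvectant_right linear_op_transvectant_right])
  have "D (lform t ^ a) (lform u ^ b) (lform v ^ c) = 0" for t u v
    using assms(4,5) by (simp add: D_def transvectant_identity_lform_powers)
  then have "D (lform t ^ a) (lform u ^ b) C = 0" for t u
    by (intro linear_op_zero_on_forms[OF lin_C _ assms(3)])
  then have "D (lform t ^ a) B C = 0" for t
    by (intro linear_op_zero_on_forms[OF lin_B _ assms(2)])
  then have "D A B C = 0"
    by (intro linear_op_zero_on_forms[OF lin_A _ assms(1)])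
  then show ?thesis
    by (simp add: D_def)
qed

end
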